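(* Given a split graph $G$ and a partial order $\pi$ on $V(G)$, one can decide in time $O(|V(G)|+|E(G)|+|\pi|)$ whether there is an MCS ordering of $G$ that is a linear extension of $\pi$.
   Context: Graphs are finite, simple, undirected, connected. A split graph is a graph whose vertex set can be partitioned into a clique and an independent set. MCS orderings: labels (sets of positive integers) start empty; for $i=1,\dots,|V(G)|$ choose an unnumbered vertex $v$ with a label of maximum cardinality among unnumbered vertices, set $\sigma(i)=v$, and add $i$ to the labels of unnumbered neighbors of $v$. A linear extension of $\pi$ is an ordering in which $x$ precedes $y$ whenever $(x,y)\in\pi$, $x\ne y$. $|\pi|$ is the number of pairs of $\pi$. *)

theory Defs
  imports Main
begin

definition simple_graph :: "'a set \<Rightarrow> 'a set set \<Rightarrow> bool" where
  "simple_graph V E \<longleftrightarrow> finite V \<and> (\<forall>e\<in>E. \<exists>u\<in>V. \<exists>v\<in>V. u \<noteq> v \<and> e = {u, v})"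

definition connected_graph :: "'a set \<Rightarrow> 'a set set \<Rightarrow> bool" where
  "connected_graph V E \<longleftrightarrow>
     V \<noteq> {} \<and> (\<forall>u\<in>V. \<forall>v\<in>V. (u, v) \<in> {(x, y). {x, y} \<in> E}\<^sup>*)"

definition clique :: "'a set set \<Rightarrow> 'a set \<Rightarrow> bool" where
  "clique E K \<longleftrightarrow> (\<forall>u\<in>K. \<forall>v\<in>K. u \<noteq> v \<longrightarrow> {u, v} \<in> E)"

definition independent :: "'a set set \<Rightarrow> 'a set \<Rightarrow> bool" where
  "independent E I \<longleftrightarrow> (\<forall>u\<in>I. \<forall>v\<in>I. {u, v} \<notin> E)"

definition split_graph :: "'a set \<Rightarrow> 'a set set \<Rightarrow> bool" where
  "split_graph V E \<longleftrightarrow>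
     (\<exists>K I. K \<union> I = V \<and> K \<inter> I = {} \<and> clique E K \<and> independent E I)"

(* An ordering is the list [sigma(1), ..., sigma(n)].  mcs_run V E xs label: maximum cardinality
   search can number exactly the vertices xs, in this order, and label then gives the current
   labels.  Positions count from 1, so the vertex appended to xs gets the number length xs + 1. *)
inductive mcs_run :: "'a set \<Rightarrow> 'a set set \<Rightarrow> 'a list \<Rightarrow> ('a \<Rightarrow> nat set) \<Rightarrow> bool"
  for V E where
  start: "mcs_run V E [] (\<lambda>_. {})"
| step: "mcs_run V E xs label \<Longrightarrow> v \<in> V - set xs \<Longrightarrow>
    \<forall>u \<in> V - set xs. card (label u) \<le> card (label v) \<Longrightarrow>
    mcs_run V E (xs @ [v])
      (\<lambda>u. if u \<in> V - set (xs @ [v]) \<and> {u, v} \<in> E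
           then insert (length xs + 1) (label u) else label u)"

definition mcs_ordering :: "'a set \<Rightarrow> 'a set set \<Rightarrow> 'a list \<Rightarrow> bool" where
  "mcs_ordering V E xs \<longleftrightarrow> (\<exists>label. mcs_run V E xs label) \<and> set xs = V"

definition linear_extension :: "'a set \<Rightarrow> ('a \<times> 'a) set \<Rightarrow> 'a list \<Rightarrow> bool" where
  "linear_extension V \<pi> xs \<longleftrightarrow> distinct xs \<and> set xs = V \<and>
     (\<forall>(x, y)\<in>\<pi>. x \<noteq> y \<longrightarrow> (\<exists>i j. i < j \<and> j < length xs \<and> xs ! i = x \<and> xs ! j = y))"


text \<open>
  The machine model is a unit-cost word RAM, presented as a structured language. A program uses
  finitely many registers and finitely many zero-initialised arrays, because register and array
  names are constants of the program text. The only arithmetic is addition and truncated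
  subtraction. A machine word holds a number below the bound \<open>W\<close>; an instruction whose result does
  not fit has no successor state, so a program that overflows gives no answer.
\<close>

record state =
  reg :: "nat \<Rightarrow> nat"
  arr :: "nat \<Rightarrow> nat \<Rightarrow> nat"

datatype test = Less nat nat | Equal nat nat

datatype prog =
    Skip
  | SetConst nat nat
  | Move nat nat
  | Add nat nat nat
  | Sub nat nat nat
  | Load nat nat nat
  | Store nat nat nat
  | Seq prog prog
  | Cond test prog prog
  | While test prog

fun holds :: "test \<Rightarrow> state \<Rightarrow> bool" where
  "holds (Less r q) s \<longleftrightarrow> reg s r < reg s q"
| "holds (Equal r q) s \<longleftrightarrow> reg s r = reg s q"

definition set_reg :: "nat \<Rightarrow> nat \<Rightarrow> state \<Rightarrow> state" where
  "set_reg r x s = s\<lparr>reg := (reg s)(r := x)\<rparr>"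

definition set_arr :: "nat \<Rightarrow> nat \<Rightarrow> nat \<Rightarrow> state \<Rightarrow> state" where
  "set_arr a i x s = s\<lparr>arr := (arr s)(a := (arr s a)(i := x))\<rparr>"

(* exec W p s t s': with word bound W, program p started in s halts in s' after exactly t steps. *)
inductive exec :: "nat \<Rightarrow> prog \<Rightarrow> state \<Rightarrow> nat \<Rightarrow> state \<Rightarrow> bool" for W where
  Skip: "exec W Skip s 1 s"
| SetConst: "n < W \<Longrightarrow> exec W (SetConst r n) s 1 (set_reg r n s)"
| Move: "exec W (Move r q) s 1 (set_reg r (reg s q) s)"
| Add: "reg s q + reg s p < W \<Longrightarrow> exec W (Add r q p) s 1 (set_reg r (reg s q + reg s p) s)"
| Sub: "exec W (Sub r q p) s 1 (set_reg r (reg s q - reg s p) s)"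
| Load: "exec W (Load r a q) s 1 (set_reg r (arr s a (reg s q)) s)"
| Store: "exec W (Store a q r) s 1 (set_arr a (reg s q) (reg s r) s)"
| Seq: "exec W c s t s' \<Longrightarrow> exec W d s' t' s'' \<Longrightarrow> exec W (Seq c d) s (t + t') s''"
| CondTrue: "holds b s \<Longrightarrow> exec W c s t s' \<Longrightarrow> exec W (Cond b c d) s (t + 1) s'"
| CondFalse: "\<not> holds b s \<Longrightarrow> exec W d s t s' \<Longrightarrow> exec W (Cond b c d) s (t + 1) s'"
| WhileFalse: "\<not> holds b s \<Longrightarrow> exec W (While b c) s 1 s"
| WhileTrue: "holds b s \<Longrightarrow> exec W c s t s' \<Longrightarrow> exec W (While b c) s' t' s'' \<Longrightarrow>
    exec W (While b c) s (t + t' + 1) s''"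

inductive_cases exec_SkipE: "exec W Skip s t s'"
inductive_cases exec_SetConstE: "exec W (SetConst r n) s t s'"
inductive_cases exec_MoveE: "exec W (Move r q) s t s'"
inductive_cases exec_AddE: "exec W (Add r q p) s t s'"
inductive_cases exec_SubE: "exec W (Sub r q p) s t s'"
inductive_cases exec_LoadE: "exec W (Load r a q) s t s'"
inductive_cases exec_StoreE: "exec W (Store a q r) s t s'"
inductive_cases exec_SeqE: "exec W (Seq c d) s t s'"
inductive_cases exec_CondE: "exec W (Cond b c d) s t s'"
inductive_cases exec_WhileE: "exec W (While b c) s t s'"

(* The run is unique, so asserting the existence of a run with some running time and answer
   determines the running time and the answer. *)
lemma exec_deterministic:
  "exec W p s t s' \<Longrightarrow> exec W p s u s'' \<Longrightarrow> u = t \<and> s'' = s'"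
proof (induction arbitrary: u s'' rule: exec.induct)
  case (Seq c s t s' d t' s2)
  from Seq.prems obtain t1 t2 r where
    r: "u = t1 + t2" "exec W c s t1 r" "exec W d r t2 s''" by (auto elim: exec_SeqE)
  with Seq.IH(1)[OF r(2)] Seq.IH(2)[of t2 s''] show ?case by simp
next
  case (CondTrue b s c t s' d)
  from CondTrue.prems CondTrue.hyps(1) obtain t1 where
    r: "u = t1 + 1" "exec W c s t1 s''" by (auto elim: exec_CondE)
  with CondTrue.IH[OF r(2)] show ?case by simp
next
  case (CondFalse b s d t s' c)
  from CondFalse.prems CondFalse.hyps(1) obtain t1 where
    r: "u = t1 + 1" "exec W d s t1 s''" by (auto elim: exec_CondE)
  with CondFalse.IH[OF r(2)] show ?case by simp
next
  case (WhileFalse b s c)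
  from WhileFalse.prems show ?case by (rule exec_WhileE) (simp_all add: WhileFalse.hyps)
next
  case (WhileTrue b s c t s' t' s2)
  from WhileTrue.prems WhileTrue.hyps(1) obtain t1 r t2 where
    r: "u = t1 + t2 + 1" "exec W c s t1 r" "exec W (While b c) r t2 s''"
    by (auto elim: exec_WhileE)
  with WhileTrue.IH(1)[OF r(2)] WhileTrue.IH(2)[of t2 s''] show ?case by simp
qed (erule exec_SkipE exec_SetConstE exec_MoveE exec_AddE exec_SubE exec_LoadE exec_StoreE, simp)+


(* The vertices are numbered 0, ..., n - 1 by an arbitrary enumeration vs.  The graph is given by
   adjacency lists and the partial order (with its reflexive pairs) by the list of its pairs; all
   these lists are without repetition and in arbitrary order. *)
definition represents ::
  "'a set \<Rightarrow> 'a set set \<Rightarrow> ('a \<times> 'a) set \<Rightarrow> 'a list \<Rightarrow> nat list list \<Rightarrow> (nat \<times> nat) list \<Rightarrow> bool"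
where
  "represents V E \<pi> vs adj ps \<longleftrightarrow>
     distinct vs \<and> set vs = V \<and>
     length adj = length vs \<and>
     (\<forall>i<length vs. distinct (adj ! i) \<and>
        set (adj ! i) = {j. j < length vs \<and> {vs ! i, vs ! j} \<in> E}) \<and>
     distinct ps \<and>
     set ps = {(i, j). i < length vs \<and> j < length vs \<and> (vs ! i, vs ! j) \<in> \<pi>}"

definition array_of :: "nat list \<Rightarrow> nat \<Rightarrow> nat" where
  "array_of xs i = (if i < length xs then xs ! i else 0)"

(* The adjacency lists are stored consecutively in array 1; the list of vertex i occupies the
   cells from arr 0 i up to, but not including, arr 0 (i + 1). *)
definition offsets :: "nat list list \<Rightarrow> nat list" where
  "offsets adj = map (\<lambda>i. length (concat (take i adj))) [0..<length adj + 1]"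

definition input_state :: "nat list list \<Rightarrow> (nat \<times> nat) list \<Rightarrow> state" where
  "input_state adj ps =
     \<lparr>reg = (\<lambda>_. 0)(0 := length adj, 1 := length ps),
      arr = (\<lambda>_ _. 0)(0 := array_of (offsets adj), 1 := array_of (concat adj),
                      2 := array_of (map fst ps), 3 := array_of (map snd ps))\<rparr>"

end

(* Let K be a clique with independent complement. In an MCS ordering, a vertex of V - K that comes
   before some vertex of K must see exactly the vertices of K numbered so far, and the rest of its
   neighbourhood is then numbered before anything else. Hence the neighbourhoods of these early
   vertices form a chain and cut K into blocks that are numbered one after the other; inside a block
   at most one early vertex may precede a vertex of K of that block. All other vertices of V - K come
   last, by decreasing degree. The vertices that the partial order forces to be early can be taken to
   be the only early ones, so the question reduces to three conditions on degrees and block numbers,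
   each of which is checked by a scan over the vertices, the edges or the pairs. Every split graph
   with clique number k has a suitable K consisting of all vertices of degree at least k and some
   vertices of degree k - 1, so K is found by counting degrees. *)

theory Submission
  imports Defs "HOL-Library.Product_Lexorder"
begin

section \<open>Split graphs\<close>

text \<open>Linear time rules out comparing neighbourhoods pairwise, and this shapes the criterion.
  The degree of an early vertex identifies its neighbourhood within the chain, so degrees serve as
  block numbers and inclusion becomes comparison of integers. For a forced vertex \<open>y\<close>,
  the clique vertices with block number at most the degree of \<open>y\<close> always include
  \<open>N y\<close>; hence equality follows from equal cardinality alone, and counting replaces
  every inclusion test. A vertex outside \<open>K\<close> is forced by a successor in
  \<open>K\<close>, or by a successor of larger degree: once all of \<open>K\<close> is numbered,
  the label of each remaining vertex has the size of its degree, so larger degrees go first. That no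
  other vertex has to be early is shown by the converse construction, whose sort key places all
  others at the end. Orderings are treated as injective rankings into an arbitrary linear order:
  necessity uses the position in an MCS ordering, sufficiency a lexicographic tuple, and the
  combinatorics never touches lists.\<close>

definition search_rank :: "'a set \<Rightarrow> ('a \<Rightarrow> 'a set) \<Rightarrow> ('a \<Rightarrow> 'b::linorder) \<Rightarrow> bool" where
  "search_rank V N f \<longleftrightarrow> inj_on f V \<and>
     (\<forall>v\<in>V. \<forall>u\<in>V. f v < f u \<longrightarrow> card {w\<in>N u. f w < f v} \<le> card {w\<in>N v. f w < f v})"

definition extends :: "('a \<times> 'a) set \<Rightarrow> ('a \<Rightarrow> 'b::linorder) \<Rightarrow> bool" where
  "extends R f \<longleftrightarrow> (\<forall>(x, y)\<in>R. x \<noteq> y \<longrightarrow> f x < f y)"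

locale neighbourhoods =
  fixes V :: "'a set" and N :: "'a \<Rightarrow> 'a set"
  assumes finV: "finite V"
    and N_sub: "v \<in> V \<Longrightarrow> N v \<subseteq> V"
    and N_sym: "u \<in> V \<Longrightarrow> v \<in> V \<Longrightarrow> u \<in> N v \<longleftrightarrow> v \<in> N u"
    and N_irrefl: "v \<in> V \<Longrightarrow> v \<notin> N v"
begin

lemma finN: "v \<in> V \<Longrightarrow> finite (N v)"
  using N_sub finV finite_subset by blast

definition split_part :: "'a set \<Rightarrow> bool" where
  "split_part K \<longleftrightarrow> K \<subseteq> V \<and> (\<forall>u\<in>K. \<forall>v\<in>K. u \<noteq> v \<longrightarrow> v \<in> N u) \<and>
     (\<forall>u\<in>V - K. \<forall>v\<in>V - K. v \<notin> N u)"

text \<open>Compare with a split clique \<open>C\<close> of maximum size. By maximality a vertex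
  outside \<open>C\<close> has degree below \<open>card C\<close>, while those inside have degree at
  least \<open>card C - 1\<close>; this gives \<open>k = card C\<close>. If \<open>K\<close> differs
  from \<open>C\<close>, the two differ by swapping one vertex \<open>w\<close> for one
  \<open>x\<close>, both with neighbourhood \<open>C - {w}\<close>, and swapping such twins
  preserves the split.\<close>

lemma split_part_by_degree:
  assumes ex: "\<exists>K. split_part K"
    and k: "k \<le> card {v\<in>V. k \<le> card (N v) + 1}"
    and k_max: "\<And>i. k < i \<Longrightarrow> card {v\<in>V. i \<le> card (N v) + 1} < i"
    and K: "{v\<in>V. k \<le> card (N v)} \<subseteq> K" "K \<subseteq> {v\<in>V. k \<le> card (N v) + 1}" "card K = k"
  shows "split_part K"
proof -
  define C where "C = arg_max card split_part"
  have bound: "\<forall>y. split_part y \<longrightarrow> card y < Suc (card V)"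
    using finV by (auto simp: split_part_def le_imp_less_Suc card_mono)
  from ex obtain C0 where "split_part C0" by blast
  have C: "split_part C" unfolding C_def
    using arg_max_natI[OF \<open>split_part C0\<close> bound] .
  have C_max: "\<And>K. split_part K \<Longrightarrow> card K \<le> card C" unfolding C_def
    using arg_max_nat_le[OF _ bound] by blast
  have CV: "C \<subseteq> V" and finC: "finite C" using C finV finite_subset by (auto simp: split_part_def)
  have inC: "C - {v} \<subseteq> N v" if "v \<in> C" for v using C that by (auto simp: split_part_def)
  have outC: "N v \<subset> C" if v: "v \<in> V - C" for v
  proof -
    have "N v \<subseteq> C" using C v N_sub by (fastforce simp: split_part_def)
    moreover have "N v \<noteq> C"
    proof
      assume "N v = C"
      have "split_part (insert v C)" unfolding split_part_def
        using C v \<open>N v = C\<close> N_sym[of _ v] CV by (auto simp: split_part_def)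
      from C_max[OF this] show False using v finC by simp
    qed
    ultimately show ?thesis by blast
  qed
  have degC: "card C \<le> card (N v) + 1" if "v \<in> C" for v
    using card_mono[OF finN inC, of v] that CV finC by auto
  have degI: "card (N v) < card C" if "v \<in> V - C" for v
    using psubset_card_mono[OF finC outC[OF that]] .
  have "card C \<le> card {v\<in>V. card C \<le> card (N v) + 1}"
    using degC CV finV by (intro card_mono) auto
  then have "card C \<le> k" using k_max[of "card C"] by linarith
  moreover have "k \<le> card C"
  proof (rule ccontr)
    assume "\<not> k \<le> card C"
    then have "v \<in> C" if "v \<in> V" "k \<le> card (N v) + 1" for v
      using degI[of v] that by (cases "v \<in> C") auto
    then have "card {v\<in>V. k \<le> card (N v) + 1} \<le> card C" using finC by (intro card_mono) auto
    then show False using k \<open>\<not> k \<le> card C\<close> by linarith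
  qed
  ultimately have kC: "card C = k" by simp
  have KV: "K \<subseteq> V" using K(2) by auto
  then have finK: "finite K" using finV finite_subset by blast
  show ?thesis
  proof (cases "K = C")
    case False
    have "\<not> K \<subseteq> C" using False K(3) kC card_subset_eq[OF finC] by metis
    then obtain x where x: "x \<in> K" "x \<notin> C" by blast
    have "\<not> C \<subseteq> K" using False K(3) kC card_subset_eq[OF finK] by metis
    then obtain w where w: "w \<in> C" "w \<notin> K" by blast
    \<comment> \<open>A vertex of \<open>C\<close> missing from \<open>K\<close> has degree below
      \<open>k\<close>, because \<open>K\<close> contains every vertex of degree at least
      \<open>k\<close>; its neighbours inside \<open>C\<close> already exhaust that degree.\<close>
    have Nw: "N w' = C - {w'}" if "w' \<in> C" "w' \<notin> K" for w'
    proof -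
      have "card (N w') < k" using that K(1) CV by force
      then have "card (N w') \<le> card (C - {w'})" using kC that finC by simp
      then show ?thesis
        using card_seteq[OF finN inC[OF that(1)]] that CV by auto
    qed
    have Nx: "N x' \<subseteq> C - {w'}" "card (N x') = k - 1"
      if "w' \<in> C" "w' \<notin> K" "x' \<in> K" "x' \<notin> C" for w' x'
    proof -
      have "w' \<notin> N x'" using Nw[OF that(1,2)] N_sym[of w' x'] that CV KV by auto
      then show "N x' \<subseteq> C - {w'}" using outC[of x'] that KV by auto
      show "card (N x') = k - 1" using degI[of x'] that K(2) kC KV by force
    qed
    have Nx': "N x = C - {w}"
      using card_subset_eq[OF _ Nx(1)[OF w x]] Nx(2)[OF w x] finC w kC by auto
    \<comment> \<open>\<open>x\<close> misses every vertex of \<open>C - K\<close>, but its degree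
      \<open>k - 1\<close> leaves room to miss only one.\<close>
    have "w' = w" if "w' \<in> C" "w' \<notin> K" for w'
      using Nx(1)[OF that x] Nx' w that by blast
    then have CK: "C - {w} \<subseteq> K" by blast
    then have "insert x (C - {w}) \<subseteq> K" using x by blast
    moreover have "card (insert x (C - {w})) = card K"
      using x w K(3) kC finC card_Suc_Diff1[OF finC w(1)] by simp
    ultimately have Keq: "K = insert x (C - {w})" using card_subset_eq[OF finK] by metis
    show ?thesis unfolding split_part_def
    proof (intro conjI ballI impI)
      fix u v assume "u \<in> K" "v \<in> K" "u \<noteq> v"
      then show "v \<in> N u" using inC Nx' N_sym[of v u] KV unfolding Keq by auto
    next
      fix u v assume uv: "u \<in> V - K" "v \<in> V - K"
      have "u = w \<or> u \<in> V - C" "v = w \<or> v \<in> V - C" using uv unfolding Keq by auto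
      then show "v \<notin> N u"
        using C uv Nw[OF w] CK N_sym[of u v] by (auto simp: split_part_def)
    qed (use KV in auto)
  qed (use C in simp)
qed

end

section \<open>Forced vertices, blocks and the feasibility criterion\<close>

locale split_order = neighbourhoods +
  fixes R :: "('a \<times> 'a) set" and K :: "'a set"
  assumes R: "partial_order_on V R"
    and K: "split_part K"
begin

definition forced :: "'a set" where
  "forced = {x\<in>V - K. \<exists>y. (x, y) \<in> R \<and> (y \<in> K \<or> card (N x) < card (N y))}"

text \<open>A clique vertex belongs to the block of the smallest forced neighbourhood containing it,
  a forced vertex to the block that completes its neighbourhood. Degrees are below
  \<open>card V\<close>, so \<open>card V\<close> marks the clique vertices without a forced
  neighbour and \<open>card V + 1\<close> the vertices that come last.\<close>

definition blk :: "'a \<Rightarrow> nat" where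
  "blk v = (if v \<in> K then Min (insert (card V) ((\<lambda>y. card (N y)) ` {y\<in>forced. v \<in> N y}))
     else if v \<in> forced then card (N v) else card V + 1)"

text \<open>The first clause is the chain condition in counted form. The third records the
  obstruction inside a block: a second vertex outside \<open>K\<close>, chosen while a clique vertex
  of the block still waits, has a smaller label than that clique vertex, which also sees the first
  one.\<close>

definition feasible :: bool where
  "feasible \<longleftrightarrow>
     (\<forall>y\<in>forced. card {v\<in>K. blk v \<le> card (N y)} = card (N y)) \<and>
     (\<forall>(x, y)\<in>R. blk x \<le> blk y) \<and>
     (\<forall>x v x' v'. (x, v) \<in> R \<and> (x', v') \<in> R \<and> x \<in> forced \<and> x' \<in> forced \<and> v \<in> K \<and> v' \<in> K \<and>
        blk x = blk v \<and> blk x' = blk v' \<and> blk x = blk x' \<longrightarrow> x = x')"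

lemma K_sub: "K \<subseteq> V" and finK: "finite K"
  using K finV finite_subset by (auto simp: split_part_def)

lemma clique_N: "u \<in> K \<Longrightarrow> v \<in> K \<Longrightarrow> u \<noteq> v \<Longrightarrow> v \<in> N u"
  using K by (auto simp: split_part_def)

lemma indep_N: "u \<in> V - K \<Longrightarrow> N u \<subseteq> K"
  using K N_sub[of u] unfolding split_part_def by blast

lemma forced_sub: "forced \<subseteq> V - K" by (auto simp: forced_def)

lemma fin_forced: "finite forced" using forced_sub finV finite_subset by blast

lemma R_V: "(x, y) \<in> R \<Longrightarrow> x \<in> V \<and> y \<in> V"
  using partial_order_onD(4)[OF R] by auto

lemma R_trans: "(x, y) \<in> R \<Longrightarrow> (y, z) \<in> R \<Longrightarrow> (x, z) \<in> R"
  using partial_order_onD(2)[OF R] by (rule transD)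

lemma R_antisym: "(x, y) \<in> R \<Longrightarrow> (y, x) \<in> R \<Longrightarrow> x = y"
  using partial_order_onD(3)[OF R] by (rule antisymD)

lemma R_refl: "x \<in> V \<Longrightarrow> (x, x) \<in> R"
  using partial_order_onD(1)[OF R] by (rule refl_onD)

lemma deg_less: "v \<in> V \<Longrightarrow> card (N v) < card V"
  using psubset_card_mono[OF finV, of "N v"] N_sub N_irrefl by blast

lemma blk_forced: "y \<in> forced \<Longrightarrow> blk y = card (N y)"
  using forced_sub by (auto simp: blk_def)

lemma blk_K_le:
  assumes "v \<in> K" "y \<in> forced" "v \<in> N y" shows "blk v \<le> card (N y)"
  using assms fin_forced by (auto simp: blk_def intro!: Min_le)

lemma blk_K_le_card: "v \<in> K \<Longrightarrow> blk v \<le> card V"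
  using fin_forced by (auto simp: blk_def intro!: Min_le)

lemma blk_K_witness:
  assumes "v \<in> K" "blk v < card V"
  obtains y where "y \<in> forced" "v \<in> N y" "blk v = card (N y)"
proof -
  let ?S = "insert (card V) ((\<lambda>y. card (N y)) ` {y\<in>forced. v \<in> N y})"
  have "Min ?S \<in> ?S" using fin_forced by (intro Min_in) auto
  then show ?thesis using assms that by (auto simp: blk_def)
qed

text \<open>Every early vertex \<open>y\<close> competes with a waiting clique vertex
  \<open>u\<close>, whose label accounts for all clique vertices numbered so far. \<open>A\<close>,
  \<open>A'\<close> and \<open>B\<close> extract what this comparison enforces; the chain of
  neighbourhoods and the three clauses follow from them.\<close>

lemma feasible_if_rank:
  fixes f :: "'a \<Rightarrow> 'b::linorder"
  assumes f: "search_rank V N f" and ext: "extends R f"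
  shows feasible
proof -
  have inj: "f u = f v \<Longrightarrow> u = v" if "u \<in> V" "v \<in> V" for u v
    using f that by (auto simp: search_rank_def dest: inj_onD)
  have step: "card {w\<in>N u. f w < f v} \<le> card {w\<in>N v. f w < f v}"
    if "v \<in> V" "u \<in> V" "f v < f u" for u v
    using f that by (auto simp: search_rank_def)
  have step_sub: "card S \<le> card {w\<in>N v. f w < f v}"
    if "v \<in> V" "u \<in> V" "f v < f u" "S \<subseteq> {w\<in>N u. f w < f v}" for u v S
    using card_mono[OF _ that(4)] finN[OF that(2)] step[OF that(1-3)] by simp
  have ext: "f x < f y" if "(x, y) \<in> R" "x \<noteq> y" for x y
    using ext that by (auto simp: extends_def)
  have clique_part: "{w\<in>K. f w < f v} \<union> {w\<in>N u. w \<notin> K \<and> f w < f v} \<subseteq> {w\<in>N u. f w < f v}"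
    if "u \<in> K" "f v \<le> f u" for u v
    using that clique_N[of u] by force
  \<comment> \<open>\<open>u\<close> sees all numbered clique vertices, whereas \<open>y\<close> can
    see only clique vertices; since \<open>y\<close> is chosen, it must see all of them.\<close>
  have A: "w \<in> N y" if "y \<in> V - K" "u \<in> K" "f y < f u" "w \<in> K" "f w < f y" for y u w
  proof -
    have uV: "u \<in> V" using that K_sub by auto
    have "card {w\<in>K. f w < f y} \<le> card {w\<in>N y. f w < f y}"
      using step_sub[of y u] clique_part[OF that(2), of y] that uV by auto
    moreover have sub: "{w\<in>N y. f w < f y} \<subseteq> {w\<in>K. f w < f y}" using indep_N[OF that(1)] by auto
    ultimately have "{w\<in>N y. f w < f y} = {w\<in>K. f w < f y}"
      using card_seteq[OF _ sub] finK by auto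
    then show "w \<in> N y" using that by auto
  qed
  \<comment> \<open>A numbered neighbour \<open>x\<close> outside \<open>K\<close> would put
    \<open>u\<close> ahead of \<open>y\<close>, whose neighbours all lie in
    \<open>K\<close>.\<close>
  have A': "x \<notin> N u"
    if "y \<in> V - K" "u \<in> K" "f y < f u" "x \<in> V - K" "f x < f y" for y u x
  proof
    assume x: "x \<in> N u"
    have uV: "u \<in> V" using that K_sub by auto
    have "insert x {w\<in>K. f w < f y} \<subseteq> {w\<in>N u. f w < f y}"
      using clique_part[OF that(2), of y] x that by auto
    then have "card (insert x {w\<in>K. f w < f y}) \<le> card {w\<in>N y. f w < f y}"
      using step_sub[of y u] that uV by blast
    also have "\<dots> \<le> card {w\<in>K. f w < f y}"
      using indep_N[OF that(1)] finK by (intro card_mono) auto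
    finally show False using that finK by simp
  qed
  \<comment> \<open>Otherwise \<open>w\<close> is chosen while \<open>u\<close> waits, and
    \<open>u\<close> also sees \<open>y\<close>; so \<open>w\<close> must make up for it with an
    earlier neighbour \<open>z\<close> outside \<open>K\<close>. Whichever of \<open>z\<close> and
    \<open>y\<close> comes first, \<open>A'\<close> is violated.\<close>
  have B: "f u < f w" if "y \<in> V - K" "u \<in> K" "w \<in> K" "u \<in> N y" "w \<notin> N y" "f y < f u" for y u w
  proof (rule ccontr)
    assume "\<not> f u < f w"
    moreover have V: "u \<in> V" "w \<in> V" "y \<in> V" using that K_sub by auto
    ultimately have wu: "f w < f u" using inj[of u w] that by fastforce
    have yw: "f y < f w"
      using A[of y u w] inj[of y w] V that by (metis DiffD2 linorder_less_linear)
    have uy: "y \<in> N u" "y \<notin> N w" using that V N_sym by auto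
    have "insert y {v\<in>K. f v < f w} \<subseteq> {v\<in>N u. f v < f w}"
      using clique_part[OF that(2), of w] uy yw wu by auto
    then have "card (insert y {v\<in>K. f v < f w}) \<le> card {v\<in>N w. f v < f w}"
      using step_sub[of w u] V wu by blast
    then have "\<not> {v\<in>N w. f v < f w} \<subseteq> {v\<in>K. f v < f w}"
      using that finK card_mono[of "{v\<in>K. f v < f w}" "{v\<in>N w. f v < f w}"] by auto
    then obtain z where z: "z \<in> N w" "z \<notin> K" "f z < f w" by auto
    then have zV: "z \<in> V - K" using N_sub[OF V(2)] by auto
    have "z \<noteq> y" using z uy by auto
    then consider "f z < f y" | "f y < f z" using inj[of z y] zV V by fastforce
    then show False
    proof cases
      case 1 then show False using A'[of y w z] that yw zV z by auto
    next
      case 2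
      have "f z < f u" using z wu by auto
      then show False using A'[of z u y] that zV 2 uy by auto
    qed
  qed
  define J where "J = {y\<in>V - K. \<exists>v\<in>K. f y < f v}"
  \<comment> \<open>A neighbour of \<open>x\<close> numbered before \<open>y\<close> is seen by
    \<open>y\<close> through \<open>A\<close>; one numbered after \<open>y\<close> would have seen
    \<open>x\<close> already, against \<open>A'\<close>.\<close>
  have J_chain: "N x \<subseteq> N y" if "x \<in> J" "y \<in> J" "f x < f y" for x y
  proof
    fix w assume w: "w \<in> N x"
    from that obtain v where v: "v \<in> K" "f y < f v" by (auto simp: J_def)
    have IJ: "x \<in> V - K" "y \<in> V - K" using that by (auto simp: J_def)
    have wK: "w \<in> K" using indep_N[OF IJ(1)] w by auto
    consider "f w < f y" | "f y < f w"
      using inj[of w y] wK IJ K_sub by (metis DiffE linorder_less_linear subsetD)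
    then show "w \<in> N y"
    proof cases
      case 1 then show ?thesis using A[of y v w] IJ v wK by auto
    next
      case 2
      have "x \<in> N w" using N_sym[of x w] w wK IJ K_sub by auto
      then show ?thesis using A'[of y w x] IJ wK 2 that by auto
    qed
  qed
  have J_mono: "N x \<subseteq> N y" if "x \<in> J" "y \<in> J" "card (N x) \<le> card (N y)" for x y
  proof (cases "x = y")
    case False
    have V: "x \<in> V" "y \<in> V" using that by (auto simp: J_def)
    then consider "f x < f y" | "f y < f x" using inj[of x y] False by fastforce
    then show ?thesis
    proof cases
      case 2
      then have "N y = N x" using J_chain[of y x] that card_seteq[OF finN[OF V(1)]] by auto
      then show ?thesis by simp
    qed (use J_chain that in blast)
  qed simp
  \<comment> \<open>With a successor \<open>z\<close> outside \<open>K\<close>, a forced vertex that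
    is not early would be chosen after all of \<open>K\<close>, when the label of \<open>z\<close>
    already has its full, larger size.\<close>
  have FJ: "y \<in> J" if "y \<in> forced" for y
  proof -
    from that obtain z where z: "(y, z) \<in> R" "z \<in> K \<or> card (N y) < card (N z)" and y: "y \<in> V - K"
      by (auto simp: forced_def)
    have yz: "y \<noteq> z" using z y by auto
    have zV: "z \<in> V" using R_V z by auto
    show ?thesis
    proof (cases "z \<in> K")
      case True then show ?thesis using ext[OF z(1) yz] y by (auto simp: J_def)
    next
      case False
      show ?thesis
      proof (rule ccontr)
        assume "y \<notin> J"
        then have all: "f v < f y" if "v \<in> K" for v
        proof -
          have "\<not> f y < f v" "v \<noteq> y" "v \<in> V" "y \<in> V"
            using \<open>y \<notin> J\<close> that y K_sub by (auto simp: J_def)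
          then show ?thesis using inj[of v y] by fastforce
        qed
        have "{w\<in>N z. f w < f y} = N z" using indep_N[of z] zV False all by auto
        then have "card (N z) \<le> card {w\<in>N y. f w < f y}"
          using step[of y z] zV y ext[OF z(1) yz] by auto
        also have "\<dots> \<le> card (N y)" using y finN by (intro card_mono) auto
        finally show False using z(2) False by auto
      qed
    qed
  qed
  have blk_N: "v \<in> N y" if "y \<in> forced" "v \<in> K" "blk v \<le> card (N y)" for y v
  proof -
    have "blk v < card V" using that deg_less[of y] forced_sub by auto
    then obtain z where "z \<in> forced" "v \<in> N z" "blk v = card (N z)"
      using blk_K_witness[OF \<open>v \<in> K\<close>] by blast
    then show ?thesis using J_mono[of z y] FJ that by auto
  qed
  have N_eq: "{v\<in>K. blk v \<le> card (N y)} = N y" if "y \<in> forced" for y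
    using that blk_N[OF that] blk_K_le indep_N forced_sub by blast
  \<comment> \<open>Transitivity passes the reason for forcing on from \<open>y\<close> to
    \<open>x\<close>: \<open>x\<close> is early and precedes \<open>y\<close>, so the chain bounds
    its degree by that of \<open>y\<close>.\<close>
  have closed: "x \<in> forced" if "(x, y) \<in> R" "y \<in> forced" "x \<in> V - K" for x y
  proof (cases "x = y")
    case False
    from \<open>y \<in> forced\<close> obtain z where z: "(y, z) \<in> R" "z \<in> K \<or> card (N y) < card (N z)"
      and y: "y \<in> V - K" by (auto simp: forced_def)
    have xz: "(x, z) \<in> R" using R_trans that z by blast
    have xy: "f x < f y" using ext that False by auto
    moreover obtain v where "v \<in> K" "f y < f v" using FJ[OF \<open>y \<in> forced\<close>] by (auto simp: J_def)
    ultimately have xJ: "x \<in> J" using that less_trans unfolding J_def by blast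
    have "card (N x) \<le> card (N y)"
      using J_chain[OF xJ FJ[OF that(2)] xy] finN[of y] y by (intro card_mono) auto
    then show ?thesis using xz z that by (auto simp: forced_def)
  qed (use that in simp)
  have mono: "blk x \<le> blk y" if xy: "(x, y) \<in> R" for x y
  proof (cases "x = y")
    case False
    have V: "x \<in> V" "y \<in> V" using R_V xy by auto
    have lt: "f x < f y" using ext xy False by auto
    show ?thesis
    proof (cases "y \<in> K \<or> y \<in> forced")
      case no: False
      then have "blk y = card V + 1" by (auto simp: blk_def)
      then show ?thesis using blk_K_le_card[of x] blk_forced[of x] deg_less[OF V(1)]
        by (cases "x \<in> K"; cases "x \<in> forced") (auto simp: blk_def)
    next
      case yes: True
      show ?thesis
      proof (cases "x \<in> K")
        case xK: True
        show ?thesis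
        proof (cases "y \<in> K")
          case yK: True
          show ?thesis
          proof (cases "blk y < card V")
            case True
            then obtain z where z: "z \<in> forced" "y \<in> N z" "blk y = card (N z)"
              using blk_K_witness[OF yK] by blast
            have zJ: "z \<in> J" "z \<in> V - K" using FJ z by (auto simp: J_def)
            \<comment> \<open>If \<open>z\<close> precedes \<open>y\<close>, then \<open>B\<close>
              would number \<open>y\<close> before \<open>x\<close>; otherwise \<open>x\<close>
              precedes \<open>z\<close> and \<open>A\<close> applies.\<close>
            have "x \<in> N z"
            proof (rule ccontr)
              assume x: "x \<notin> N z"
              consider "f z < f y" | "f y < f z"
                using inj[of z y] zJ V yK by fastforce
              then show False
              proof cases
                case 1 then show False using B[of z y x] x z zJ xK yK lt by auto
              next
                case 2
                obtain v where "v \<in> K" "f z < f v" using zJ by (auto simp: J_def)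
                then show False using A[of z v x] zJ xK less_trans[OF lt 2] x by auto
              qed
            qed
            then show ?thesis using blk_K_le[OF xK z(1)] z by simp
          qed (use blk_K_le_card[OF xK] in simp)
        next
          case False
          then have yF: "y \<in> forced" using yes by simp
          then obtain v where "v \<in> K" "f y < f v" using FJ by (auto simp: J_def)
          then have "x \<in> N y" using A[of y v x] xK lt V False by auto
          then show ?thesis using blk_K_le[OF xK yF] blk_forced[OF yF] by simp
        qed
      next
        case xI: False
        have xF: "x \<in> forced"
          using xy V xI yes closed by (auto simp: forced_def)
        show ?thesis
        proof (cases "y \<in> K")
          case yK: True
          show ?thesis
          proof (rule ccontr)
            assume "\<not> blk x \<le> blk y"
            then have less: "blk y < card (N x)" using blk_forced[OF xF] by simp
            then have "blk y < card V" using deg_less[OF V(1)] by simp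
            then obtain z where z: "z \<in> forced" "y \<in> N z" "blk y = card (N z)"
              using blk_K_witness[OF yK] by blast
            have zJ: "z \<in> J" "z \<in> V - K" using FJ z by (auto simp: J_def)
            \<comment> \<open>The vertex \<open>z\<close> with the smaller neighbourhood is the
              earlier one, so its neighbour \<open>y\<close> would already have seen it when
              \<open>x\<close> is chosen, against \<open>A'\<close>.\<close>
            have "\<not> N x \<subseteq> N z" using card_mono[OF finN, of z "N x"] less z zJ by auto
            then have "f z < f x"
              using J_chain[OF FJ[OF xF] zJ(1)] inj[of x z] V zJ by fastforce
            moreover have "z \<in> N y" using N_sym[of z y] zJ V z by auto
            ultimately show False using A'[of x y z] V xI yK lt zJ by auto
          qed
        next
          case False
          then have yF: "y \<in> forced" using yes by simp
          show ?thesis using J_chain[OF FJ[OF xF] FJ[OF yF] lt] blk_forced xF yF finN[of y] V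
            by (auto intro: card_mono)
        qed
      qed
    qed
  qed simp
  \<comment> \<open>\<open>v'\<close> shares the block of \<open>x\<close> and hence lies in
    \<open>N x\<close>; it still waits when \<open>x'\<close> is chosen, so \<open>A'\<close>
    forbids that \<open>x\<close> was chosen before.\<close>
  have front: "\<not> f x < f x'"
    if "(x, v) \<in> R" "(x', v') \<in> R" "x \<in> forced" "x' \<in> forced" "v \<in> K" "v' \<in> K"
      "blk x = blk v" "blk x' = blk v'" "blk x = blk x'" for x x' v v'
  proof
    assume "f x < f x'"
    moreover have "v' \<in> N x" using N_eq[OF that(3)] that blk_forced by auto
    moreover have "x \<in> V - K" "x' \<in> V - K" "v' \<in> V" using that forced_sub K_sub by auto
    moreover have "f x' < f v'" using ext[OF that(2)] that calculation by auto
    ultimately show False using A'[of x' v' x] N_sym[of x v'] that by auto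
  qed
  have front_eq: "x = x'" if "(x, v) \<in> R" "(x', v') \<in> R" "x \<in> forced" "x' \<in> forced" "v \<in> K" "v' \<in> K"
      "blk x = blk v" "blk x' = blk v'" "blk x = blk x'" for x x' v v'
  proof -
    have "\<not> f x < f x'" using front that by blast
    moreover have "\<not> f x' < f x" using front[of x' v' x v] that by simp
    ultimately show ?thesis using inj[of x x'] R_V that by fastforce
  qed
  show ?thesis unfolding feasible_def
    using N_eq mono front_eq by auto
qed

section \<open>A ranking constructed from the criterion\<close>

definition front :: "'a \<Rightarrow> bool" where
  "front y \<longleftrightarrow> y \<in> forced \<and> (\<exists>v\<in>K. (y, v) \<in> R \<and> blk v = blk y)"

text \<open>Order inside a block: slot 1 is for the single front vertex, 0 for the clique vertices
  required before it, 2 for the other clique vertices, and 3 for the remaining forced vertices,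
  whose neighbourhoods are complete by then. The last branch sorts by decreasing degree.\<close>

definition sub :: "'a \<Rightarrow> nat" where
  "sub v = (if v \<in> K then (if \<exists>y. front y \<and> (v, y) \<in> R \<and> blk y = blk v then 0 else 2)
     else if v \<in> forced then (if front v then 1 else 3) else card V - card (N v))"

definition down :: "'a \<Rightarrow> nat" where
  "down v = card {w. (w, v) \<in> R}"

lemma down_less:
  assumes "(x, y) \<in> R" "x \<noteq> y" shows "down x < down y"
proof -
  have "{w. (w, x) \<in> R} \<subset> {w. (w, y) \<in> R}"
    using assms R_trans R_antisym R_refl R_V by blast
  moreover have "finite {w. (w, y) \<in> R}"
    by (rule finite_subset[OF _ finV]) (use R_V in auto)
  ultimately show ?thesis unfolding down_def by (rule psubset_card_mono[rotated])
qed

text \<open>\<open>N y\<close> is contained in the set counted by the first clause, so equal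
  cardinality makes the two sets equal.\<close>

lemma feasible_N:
  assumes "feasible" "y \<in> forced" "v \<in> K" "blk v \<le> blk y"
  shows "v \<in> N y"
proof -
  have "N y \<subseteq> {v\<in>K. blk v \<le> card (N y)}"
    using blk_K_le[OF _ assms(2)] indep_N[of y] forced_sub assms(2) by blast
  moreover have "card {v\<in>K. blk v \<le> card (N y)} = card (N y)"
    using assms by (auto simp: feasible_def)
  ultimately have "N y = {v\<in>K. blk v \<le> card (N y)}"
    using finK card_subset_eq[of "{v\<in>K. blk v \<le> card (N y)}" "N y"] by auto
  then show ?thesis using assms blk_forced[of y] by auto
qed

lemma feasible_front_unique:
  assumes "feasible" "front x" "front y" "blk x = blk y" shows "x = y"
  using assms unfolding feasible_def front_def by fastforce

lemma blk_other: "v \<in> V - K \<Longrightarrow> v \<notin> forced \<Longrightarrow> blk v = card V + 1"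
  by (auto simp: blk_def)

lemma blk_forced_less: "v \<in> forced \<Longrightarrow> blk v < card V"
  using blk_forced deg_less forced_sub by auto

end

text \<open>The last component only makes the key injective; the number of predecessors is what breaks
  ties consistently with the partial order.\<close>

lemma (in split_order) rank_if_feasible:
  fixes i :: "'a \<Rightarrow> 'b::linorder"
  assumes feas: feasible and i: "inj_on i V"
  shows "\<exists>f :: 'a \<Rightarrow> nat \<times> nat \<times> nat \<times> 'b. search_rank V N f \<and> extends R f"
proof -
  define f where "f v = (blk v, sub v, down v, i v)" for v
  have less_blk: "blk u \<le> blk v" if "f u < f v" for u v using that by (auto simp: f_def)
  have less_sub: "sub u \<le> sub v" if "f u < f v" "blk u = blk v" for u v
    using that by (auto simp: f_def)
  have kind: "v \<in> K \<and> blk v \<le> card V \<or> v \<in> forced \<and> blk v < card V \<or>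
      v \<in> V - K \<and> v \<notin> forced \<and> blk v = card V + 1" if "v \<in> V" for v
    using that blk_K_le_card blk_forced_less blk_other by blast
  \<comment> \<open>For \<open>v\<close> in \<open>K\<close> or forced, the earlier neighbours of
    \<open>u\<close> are shown to be neighbours of \<open>v\<close>, so the comparison of
    cardinalities comes from an inclusion. Only in the final group are degrees compared.\<close>
  have step: "card {w\<in>N u. f w < f v} \<le> card {w\<in>N v. f w < f v}"
    if V: "v \<in> V" "u \<in> V" and less: "f v < f u" for u v
  proof -
    consider "v \<in> K" | "v \<in> forced" | "v \<in> V - K" "v \<notin> forced" using V by blast
    then show ?thesis
    proof cases
      case vK: 1
      have "{w\<in>N u. f w < f v} \<subseteq> {w\<in>N v. f w < f v}"
      proof safe
        fix w assume w: "w \<in> N u" "f w < f v"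
        have wV: "w \<in> V" using N_sub[OF V(2)] w by auto
        show "w \<in> N v"
        proof (cases "w \<in> K")
          case True then show ?thesis using clique_N[OF vK, of w] w by auto
        next
          case False
          have "blk w \<le> card V" using less_blk[OF w(2)] kind[OF V(1)] vK forced_sub by auto
          then have wF: "w \<in> forced" using kind[OF wV] False by auto
          have uK: "u \<in> K" using indep_N[of u] V w False by blast
          have uw: "u \<in> N w" using N_sym V wV w by blast
          have "blk u \<le> blk w" using blk_K_le[OF uK wF uw] blk_forced[OF wF] by simp
          then have "blk v \<le> blk w" using less_blk[OF less] by simp
          then have "v \<in> N w" using feasible_N[OF feas wF vK] by simp
          then show ?thesis using N_sym V wV by blast
        qed
      qed
      then show ?thesis using finN[OF V(1)] by (intro card_mono) auto
    next
      case vF: 2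
      have "{w\<in>N u. f w < f v} \<subseteq> {w\<in>N v. f w < f v}"
      proof safe
        fix w assume w: "w \<in> N u" "f w < f v"
        have wV: "w \<in> V" using N_sub[OF V(2)] w by auto
        show "w \<in> N v"
        proof (cases "w \<in> K")
          case True then show ?thesis using feasible_N[OF feas vF True] less_blk[OF w(2)] by simp
        next
          case False
          have "blk w \<le> card V" using less_blk[OF w(2)] blk_forced_less[OF vF] by auto
          then have wF: "w \<in> forced" using kind[OF wV] False by auto
          have uK: "u \<in> K" using indep_N[of u] V w False by blast
          have uw: "u \<in> N w" using N_sym V wV w by blast
          have "blk u \<le> blk w" using blk_K_le[OF uK wF uw] blk_forced[OF wF] by simp
          then have eq: "blk u = blk v" "blk w = blk v"
            using less_blk[OF less] less_blk[OF w(2)] by auto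
          \<comment> \<open>All three vertices share a block, so the second component decides. As
            \<open>u\<close> is in \<open>K\<close>, first \<open>v\<close> and then
            \<open>w\<close> must be front vertices; uniqueness gives \<open>w = v\<close>, which
            contradicts that \<open>w\<close> precedes \<open>v\<close>.\<close>
          have "sub u \<le> 2" using uK by (auto simp: sub_def)
          then have "sub v \<le> 2" using less_sub[OF less] eq by simp
          then have vf: "front v" using vF forced_sub by (auto simp: sub_def split: if_splits)
          then have "sub v = 1" using vF forced_sub by (auto simp: sub_def)
          then have "sub w \<le> 1" using less_sub[OF w(2)] eq by simp
          then have "front w" using wF False by (auto simp: sub_def split: if_splits)
          then have "w = v" using feasible_front_unique[OF feas _ vf] eq by simp
          then show ?thesis using w by simp
        qed
      qed
      then show ?thesis using finN[OF V(1)] by (intro card_mono) auto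
    next
      case vO: 3
      \<comment> \<open>Everything after \<open>v\<close> also lies in the final group. All of
        \<open>K\<close> is numbered by then, so \<open>v\<close> sees its entire neighbourhood, and
        the sorting by degree settles the comparison.\<close>
      have "blk u \<ge> card V + 1" using less_blk[OF less] blk_other[OF vO] by simp
      then have uO: "u \<in> V - K" "u \<notin> forced" "blk u = blk v"
        using kind[OF V(2)] blk_other[OF vO] by auto
      have "sub v \<le> sub u" using less_sub[OF less] uO by simp
      then have le: "card (N u) \<le> card (N v)"
        using vO uO deg_less[OF V(1)] deg_less[OF V(2)] by (auto simp: sub_def)
      have "f w < f v" if "w \<in> K" for w
        using blk_K_le_card[OF that] blk_other[OF vO] by (auto simp: f_def)
      then have "{w\<in>N v. f w < f v} = N v" using indep_N[OF vO(1)] by auto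
      moreover have "card {w\<in>N u. f w < f v} \<le> card (N u)"
        using finN[OF V(2)] by (intro card_mono) auto
      ultimately show ?thesis using le by simp
    qed
  qed
  have ext: "f x < f y" if xy: "(x, y) \<in> R" "x \<noteq> y" for x y
  proof -
    have V: "x \<in> V" "y \<in> V" using R_V[OF xy(1)] by auto
    have "blk x \<le> blk y" using feas xy by (auto simp: feasible_def)
    moreover have "sub x \<le> sub y" if eq: "blk x = blk y"
    proof -
      consider "x \<in> K" "y \<in> K" | "x \<in> K" "y \<in> forced" | "x \<in> forced" "y \<in> K" |
        "x \<in> forced" "y \<in> forced" | "x \<in> V - K" "x \<notin> forced" "y \<in> V - K" "y \<notin> forced"
        using kind[OF V(1)] kind[OF V(2)] eq by auto
      then show ?thesis
      proof cases
        case 1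
        then show ?thesis using eq R_trans[OF xy(1)] by (auto simp: sub_def)
      next
        case 2
        then show ?thesis using xy eq forced_sub by (auto simp: sub_def)
      next
        case 3
        then have fx: "front x" using xy eq by (auto simp: front_def)
        \<comment> \<open>\<open>x\<close> is the only front vertex of the block, and antisymmetry
          keeps \<open>y\<close> from preceding it, so \<open>y\<close> sits in slot 2.\<close>
        have "\<not> (\<exists>z. front z \<and> (y, z) \<in> R \<and> blk z = blk y)"
          using feasible_front_unique[OF feas _ fx] R_antisym xy eq by metis
        then show ?thesis using 3 fx forced_sub by (auto simp: sub_def)
      next
        case 4
        have "front x" if "front y" using that 4 eq R_trans[OF xy(1)] by (auto simp: front_def)
        then show ?thesis using 4 forced_sub by (auto simp: sub_def)
      next
        case 5
        then have "card (N y) \<le> card (N x)" using xy by (force simp: forced_def)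
        then show ?thesis using 5 by (auto simp: sub_def)
      qed
    qed
    ultimately show ?thesis using down_less[OF xy] by (auto simp: f_def less_le)
  qed
  have "inj_on f V" using i by (auto simp: inj_on_def f_def)
  then have "search_rank V N f" using step by (auto simp: search_rank_def)
  moreover have "extends R f" using ext by (auto simp: extends_def)
  ultimately show ?thesis by blast
qed

section \<open>MCS orderings as rankings of the vertices\<close>

definition visited_nbrs :: "'a set set \<Rightarrow> 'a list \<Rightarrow> 'a \<Rightarrow> 'a set" where
  "visited_nbrs E xs u = {w\<in>set xs. {u, w} \<in> E}"

definition greedy :: "'a set \<Rightarrow> 'a set set \<Rightarrow> 'a list \<Rightarrow> bool" where
  "greedy V E xs \<longleftrightarrow> (\<forall>i<length xs. \<forall>u\<in>V - set (take i xs).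
     card (visited_nbrs E (take i xs) u) \<le> card (visited_nbrs E (take i xs) (xs ! i)))"

lemma greedy_snoc:
  "greedy V E (xs @ [v]) \<longleftrightarrow> greedy V E xs \<and>
     (\<forall>u\<in>V - set xs. card (visited_nbrs E xs u) \<le> card (visited_nbrs E xs v))"
  by (auto simp: greedy_def nth_append less_Suc_eq)

text \<open>Only the sizes of labels guide the search. Since labels stay within
  \<open>{1..length xs}\<close>, each inserted number is new, and so the sizes count visited
  neighbours.\<close>

lemma mcs_run_invariant:
  "mcs_run V E xs label \<Longrightarrow> distinct xs \<and> set xs \<subseteq> V \<and> greedy V E xs \<and>
     (\<forall>u\<in>V - set xs. label u \<subseteq> {1..length xs} \<and> card (label u) = card (visited_nbrs E xs u))"
proof (induction rule: mcs_run.induct)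
  case start then show ?case by (simp add: greedy_def visited_nbrs_def)
next
  case (step xs label v)
  have lab: "label u \<subseteq> {1..length xs}" "card (label u) = card (visited_nbrs E xs u)"
    if "u \<in> V - set xs" for u using step that by auto
  have "greedy V E (xs @ [v])" using step by (auto simp: greedy_snoc)
  moreover have "insert (length xs + 1) (label u) \<subseteq> {1..length (xs @ [v])} \<and>
      card (insert (length xs + 1) (label u)) = card (visited_nbrs E (xs @ [v]) u)"
    if u: "u \<in> V - set (xs @ [v])" "{u, v} \<in> E" for u
  proof -
    have "visited_nbrs E (xs @ [v]) u = insert v (visited_nbrs E xs u)"
      using u by (auto simp: visited_nbrs_def)
    moreover have "v \<notin> visited_nbrs E xs u" "finite (visited_nbrs E xs u)"
      using step.hyps by (auto simp: visited_nbrs_def)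
    moreover have "length xs + 1 \<notin> label u" "finite (label u)"
      using lab(1)[of u] u finite_subset by fastforce+
    ultimately show ?thesis using lab[of u] u by force
  qed
  moreover have "label u \<subseteq> {1..length (xs @ [v])} \<and> card (label u) = card (visited_nbrs E (xs @ [v]) u)"
    if u: "u \<in> V - set (xs @ [v])" "{u, v} \<notin> E" for u
  proof -
    have "visited_nbrs E (xs @ [v]) u = visited_nbrs E xs u"
      using u by (auto simp: visited_nbrs_def)
    then show ?thesis using lab[of u] u by force
  qed
  ultimately show ?case using step by auto
qed

lemma mcs_run_exists:
  "distinct xs \<Longrightarrow> set xs \<subseteq> V \<Longrightarrow> greedy V E xs \<Longrightarrow> \<exists>label. mcs_run V E xs label"
proof (induction xs rule: rev_induct)
  case Nil then show ?case using mcs_run.start by blast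
next
  case (snoc v xs)
  then obtain label where run: "mcs_run V E xs label" by (auto simp: greedy_snoc)
  have "\<forall>u\<in>V - set xs. card (label u) \<le> card (label v)"
    using snoc.prems mcs_run_invariant[OF run] by (auto simp: greedy_snoc)
  moreover have "v \<in> V - set xs" using snoc.prems by auto
  ultimately show ?case using mcs_run.step[OF run] by blast
qed

lemma mcs_ordering_iff_greedy:
  "mcs_ordering V E xs \<longleftrightarrow> distinct xs \<and> set xs = V \<and> greedy V E xs"
  unfolding mcs_ordering_def using mcs_run_invariant mcs_run_exists by (metis order_refl)

lemma set_take_conv_nth: "p \<le> length xs \<Longrightarrow> set (take p xs) = {xs ! q | q. q < p}"
  by (auto simp flip: nth_image)

text \<open>The ranking \<open>f\<close> is the position in \<open>xs\<close>. It is taken on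
  indices of \<open>vs\<close> because that is the form in which the program sees the graph and the
  order.\<close>

lemma rank_if_ordering:
  assumes vs: "distinct vs" "set vs = V"
    and xs: "mcs_ordering V E xs" "linear_extension V \<pi> xs"
  shows "\<exists>f :: nat \<Rightarrow> nat.
     search_rank {..<length vs} (\<lambda>i. {j. j < length vs \<and> {vs ! i, vs ! j} \<in> E}) f \<and>
     extends {(i, j). i < length vs \<and> j < length vs \<and> (vs ! i, vs ! j) \<in> \<pi>} f"
proof -
  let ?n = "length vs"
  have xs': "distinct xs" "set xs = V" "greedy V E xs" using xs by (auto simp: mcs_ordering_iff_greedy)
  have len: "length xs = ?n" using xs' vs distinct_card by metis
  have "\<forall>i<?n. \<exists>p<?n. xs ! p = vs ! i" using xs' vs len by (metis in_set_conv_nth nth_mem)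
  then obtain f where f: "f i < ?n" "xs ! f i = vs ! i" if "i < ?n" for i by metis
  have f_eq: "f i = p" if "i < ?n" "p < ?n" "xs ! p = vs ! i" for i p
    using nth_eq_iff_index_eq[OF xs'(1)] f[OF that(1)] that len by metis
  have inj: "inj_on f {..<?n}"
    using f nth_eq_iff_index_eq[OF vs(1)] by (auto simp: inj_on_def) metis
  have card_eq: "card {w\<in>{j. j < ?n \<and> {vs ! u, vs ! j} \<in> E}. f w < f v} =
      card (visited_nbrs E (take (f v) xs) (vs ! u))" if "v < ?n" "u < ?n" for u v
  proof -
    have fv: "f v < ?n" using f that by simp
    have "visited_nbrs E (take (f v) xs) (vs ! u) = (!) vs ` {w\<in>{j. j < ?n \<and> {vs ! u, vs ! j} \<in> E}. f w < f v}"
    proof (intro equalityI subsetI)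
      fix x assume "x \<in> visited_nbrs E (take (f v) xs) (vs ! u)"
      then obtain q where q: "q < f v" "x = xs ! q" "{vs ! u, x} \<in> E"
        using fv len by (auto simp: visited_nbrs_def set_take_conv_nth)
      then have "x \<in> set xs" using fv len by simp
      then have "x \<in> set vs" by (simp only: xs'(2) vs(2))
      then obtain i where "i < ?n" "x = vs ! i" by (metis in_set_conv_nth)
      moreover have "f i = q" using f_eq[of i q] q calculation fv by auto
      ultimately show "x \<in> (!) vs ` {w\<in>{j. j < ?n \<and> {vs ! u, vs ! j} \<in> E}. f w < f v}" using q by auto
    next
      fix x assume "x \<in> (!) vs ` {w\<in>{j. j < ?n \<and> {vs ! u, vs ! j} \<in> E}. f w < f v}"
      then obtain w where w: "w < ?n" "{vs ! u, vs ! w} \<in> E" "f w < f v" "x = vs ! w" by auto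
      have "x = xs ! f w" using f(2)[OF w(1)] w by simp
      then show "x \<in> visited_nbrs E (take (f v) xs) (vs ! u)"
        using w fv len by (auto simp: visited_nbrs_def set_take_conv_nth)
    qed
    moreover have "inj_on ((!) vs) {w\<in>{j. j < ?n \<and> {vs ! u, vs ! j} \<in> E}. f w < f v}"
      using inj_on_nth[OF vs(1)] by auto
    ultimately show ?thesis by (simp only: card_image)
  qed
  have "card (visited_nbrs E (take (f v) xs) (vs ! u)) \<le> card (visited_nbrs E (take (f v) xs) (vs ! v))"
    if "v < ?n" "u < ?n" "f v < f u" for u v
  proof -
    have "vs ! u \<noteq> xs ! q" if "q < f v" for q
      using f_eq[OF \<open>u < ?n\<close>, of q] f(1)[OF \<open>v < ?n\<close>] that \<open>f v < f u\<close> by auto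
    then have "vs ! u \<notin> set (take (f v) xs)"
      using f(1)[OF that(1)] len by (auto simp: set_take_conv_nth)
    moreover have "vs ! u \<in> V" using vs that by auto
    ultimately show ?thesis using xs'(3) f[OF that(1)] len by (auto simp: greedy_def)
  qed
  then have "search_rank {..<?n} (\<lambda>i. {j. j < ?n \<and> {vs ! i, vs ! j} \<in> E}) f"
    using inj card_eq by (simp add: search_rank_def)
  moreover have "f i < f j" if "i < ?n" "j < ?n" "(vs ! i, vs ! j) \<in> \<pi>" "i \<noteq> j" for i j
  proof -
    have "vs ! i \<noteq> vs ! j" using that vs by (simp add: nth_eq_iff_index_eq)
    moreover have "\<forall>(x, y)\<in>\<pi>. x \<noteq> y \<longrightarrow> (\<exists>i j. i < j \<and> j < length xs \<and> xs ! i = x \<and> xs ! j = y)"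
      using xs(2) by (simp add: linear_extension_def)
    note bspec[OF this that(3)]
    ultimately obtain p q where "p < q" "q < length xs" "xs ! p = vs ! i" "xs ! q = vs ! j"
      by auto
    then show ?thesis using f_eq[OF that(1), of p] f_eq[OF that(2), of q] len by auto
  qed
  ultimately show ?thesis by (auto simp: extends_def)
qed

text \<open>Sorting the indices by \<open>f\<close> gives the ordering: the indices before position
  \<open>p\<close> are exactly those ranked below \<open>ys ! p\<close>, which turns
  \<open>visited_nbrs\<close> into the set counted in \<open>search_rank\<close>.\<close>

lemma ordering_if_rank:
  fixes f :: "nat \<Rightarrow> 'b::linorder"
  assumes vs: "distinct vs" "set vs = V" and \<pi>: "\<pi> \<subseteq> V \<times> V"
    and rank: "search_rank {..<length vs} (\<lambda>i. {j. j < length vs \<and> {vs ! i, vs ! j} \<in> E}) f"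
    and ext: "extends {(i, j). i < length vs \<and> j < length vs \<and> (vs ! i, vs ! j) \<in> \<pi>} f"
  shows "\<exists>xs. mcs_ordering V E xs \<and> linear_extension V \<pi> xs"
proof -
  let ?n = "length vs"
  define ys where "ys = sort_key f [0..<?n]"
  define xs where "xs = map ((!) vs) ys"
  have ys: "set ys = {..<?n}" "distinct ys" "length ys = ?n" "sorted (map f ys)"
    by (auto simp: ys_def)
  have inj: "inj_on f {..<?n}" using rank by (simp add: search_rank_def)
  have ext': "f i < f j" if "i < ?n" "j < ?n" "(vs ! i, vs ! j) \<in> \<pi>" "i \<noteq> j" for i j
    using ext that by (auto simp: extends_def)
  have less: "f (ys ! p) < f (ys ! q) \<longleftrightarrow> p < q" if "p < ?n" "q < ?n" for p q
  proof -
    have mono: "f (ys ! p) < f (ys ! q)" if "p < q" "q < ?n" for p q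
    proof -
      have "f (ys ! p) \<le> f (ys ! q)" using sorted_nth_mono[OF ys(4), of p q] that ys by simp
      moreover have "ys ! p \<noteq> ys ! q" using nth_eq_iff_index_eq[OF ys(2)] that ys by auto
      moreover have "ys ! p \<in> set ys" "ys ! q \<in> set ys" using that ys(3) by auto
      ultimately show ?thesis using inj ys(1) by (metis inj_onD order_le_less)
    qed
    show ?thesis using mono[of p q] mono[of q p] that by (metis less_irrefl less_asym nat_neq_iff)
  qed
  have yn: "ys ! p < ?n" if "p < ?n" for p using that ys nth_mem by (metis lessThan_iff)
  have take_ys: "set (take p ys) = {w. w < ?n \<and> f w < f (ys ! p)}" if "p < ?n" for p
  proof (intro equalityI subsetI)
    fix w assume "w \<in> {w. w < ?n \<and> f w < f (ys ! p)}"
    moreover obtain q where "q < ?n" "w = ys ! q" using calculation ys by (metis in_set_conv_nth lessThan_iff mem_Collect_eq)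
    ultimately show "w \<in> set (take p ys)" using less that ys by (auto simp: set_take_conv_nth)
  qed (use that ys less yn in \<open>auto simp: set_take_conv_nth\<close>)
  have "set xs = (!) vs ` {..<?n}" using ys(1) by (simp add: xs_def)
  also have "\<dots> = V" using vs by (auto simp: in_set_conv_nth)
  finally have setxs: "set xs = V" .
  have xs_ex: "\<exists>p<?n. x = vs ! (ys ! p)" if "x \<in> set xs" for x
    using that ys(3) by (metis in_set_conv_nth length_map nth_map xs_def)
  have dist: "distinct xs"
    using ys inj_on_nth[OF vs(1), of "{..<?n}"] by (simp add: xs_def distinct_map)
  have visited: "card (visited_nbrs E (take p xs) (vs ! u)) =
      card {w\<in>{j. j < ?n \<and> {vs ! u, vs ! j} \<in> E}. f w < f (ys ! p)}" if "p < ?n" "u < ?n" for p u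
  proof -
    have "visited_nbrs E (take p xs) (vs ! u) = (!) vs ` {w\<in>{j. j < ?n \<and> {vs ! u, vs ! j} \<in> E}. f w < f (ys ! p)}"
      using take_ys[OF that(1)] by (auto simp: visited_nbrs_def xs_def take_map)
    moreover have "inj_on ((!) vs) {w\<in>{j. j < ?n \<and> {vs ! u, vs ! j} \<in> E}. f w < f (ys ! p)}"
      using inj_on_nth[OF vs(1)] by auto
    ultimately show ?thesis by (simp only: card_image)
  qed
  have "card (visited_nbrs E (take p xs) x) \<le> card (visited_nbrs E (take p xs) (xs ! p))"
    if "p < length xs" "x \<in> V" "x \<notin> set (take p xs)" for p x
  proof -
    have p: "p < ?n" using that ys by (simp add: xs_def)
    have "x \<in> set xs" using that setxs by simp
    then obtain q where q: "q < ?n" "x = vs ! (ys ! q)" using xs_ex by blast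
    have "\<not> q < p" using that q p ys by (auto simp: set_take_conv_nth xs_def)
    moreover have "xs ! p = vs ! (ys ! p)" using p ys by (simp add: xs_def)
    ultimately show ?thesis
    proof (cases "q = p")
      case False
      then have "f (ys ! p) < f (ys ! q)" using less[OF p q(1)] \<open>\<not> q < p\<close> by auto
      then show ?thesis using rank yn[OF p] yn[OF q(1)] visited[OF p] q \<open>xs ! p = _\<close>
        by (simp add: search_rank_def)
    qed (use q in simp)
  qed
  then have "mcs_ordering V E xs"
    using dist setxs by (auto simp: mcs_ordering_iff_greedy greedy_def)
  moreover have "\<exists>i j. i < j \<and> j < length xs \<and> xs ! i = x \<and> xs ! j = y" if "(x, y) \<in> \<pi>" "x \<noteq> y" for x y
  proof -
    have "x \<in> set xs" "y \<in> set xs" using that \<pi> setxs by auto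
    then obtain p q where pq: "p < ?n" "x = vs ! (ys ! p)" "q < ?n" "y = vs ! (ys ! q)"
      using xs_ex by metis
    then have "ys ! p \<noteq> ys ! q" "(vs ! (ys ! p), vs ! (ys ! q)) \<in> \<pi>" using that by auto
    then have "f (ys ! p) < f (ys ! q)" using ext' yn pq by simp
    then have "p < q" using less pq by simp
    then show ?thesis using pq ys by (intro exI[of _ p] exI[of _ q]) (simp add: xs_def)
  qed
  ultimately show ?thesis using dist setxs by (auto simp: linear_extension_def)
qed

section \<open>Running time and frames of programs\<close>

text \<open>Total correctness with a time bound; the existence of the run also certifies that no
  instruction overflows.\<close>

definition runs :: "nat \<Rightarrow> prog \<Rightarrow> state \<Rightarrow> nat \<Rightarrow> (state \<Rightarrow> bool) \<Rightarrow> bool" where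
  "runs W p s T Q \<longleftrightarrow> (\<exists>t s'. exec W p s t s' \<and> t \<le> T \<and> Q s')"

text \<open>Syntactic write sets yield frame conditions for every program, so that a loop invariant
  only has to mention what the loop changes.\<close>

primrec written_regs :: "prog \<Rightarrow> nat set" where
  "written_regs Skip = {}"
| "written_regs (SetConst r n) = {r}"
| "written_regs (Move r q) = {r}"
| "written_regs (Add r q p) = {r}"
| "written_regs (Sub r q p) = {r}"
| "written_regs (Load r a q) = {r}"
| "written_regs (Store a q r) = {}"
| "written_regs (Seq c d) = written_regs c \<union> written_regs d"
| "written_regs (Cond b c d) = written_regs c \<union> written_regs d"
| "written_regs (While b c) = written_regs c"

primrec written_arrs :: "prog \<Rightarrow> nat set" where
  "written_arrs Skip = {}"
| "written_arrs (SetConst r n) = {}"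
| "written_arrs (Move r q) = {}"
| "written_arrs (Add r q p) = {}"
| "written_arrs (Sub r q p) = {}"
| "written_arrs (Load r a q) = {}"
| "written_arrs (Store a q r) = {a}"
| "written_arrs (Seq c d) = written_arrs c \<union> written_arrs d"
| "written_arrs (Cond b c d) = written_arrs c \<union> written_arrs d"
| "written_arrs (While b c) = written_arrs c"

definition frame :: "prog \<Rightarrow> state \<Rightarrow> state \<Rightarrow> bool" where
  "frame p s s' \<longleftrightarrow> (\<forall>r. r \<notin> written_regs p \<longrightarrow> reg s' r = reg s r) \<and>
     (\<forall>a. a \<notin> written_arrs p \<longrightarrow> arr s' a = arr s a)"

lemma frame_reg: "frame p s s' \<Longrightarrow> r \<notin> written_regs p \<Longrightarrow> reg s' r = reg s r"
  and frame_arr: "frame p s s' \<Longrightarrow> a \<notin> written_arrs p \<Longrightarrow> arr s' a = arr s a"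
  by (auto simp: frame_def)

lemma frame_refl: "frame p s s"
  by (simp add: frame_def)

lemma frame_trans: "frame p s s' \<Longrightarrow> frame p s' s'' \<Longrightarrow> frame p s s''"
  by (simp add: frame_def)

lemma reg_set_reg [simp]: "reg (set_reg r x s) = (reg s)(r := x)"
  and arr_set_reg [simp]: "arr (set_reg r x s) = arr s"
  and reg_set_arr [simp]: "reg (set_arr a i x s) = reg s"
  and arr_set_arr [simp]: "arr (set_arr a i x s) = (arr s)(a := (arr s a)(i := x))"
  by (simp_all add: set_reg_def set_arr_def)

lemma exec_frame: "exec W p s t s' \<Longrightarrow> frame p s s'"
  by (induction rule: exec.induct) (auto simp: frame_def)

lemma runs_mono:
  assumes "runs W p s T Q" "T \<le> T'" "\<And>s'. frame p s s' \<Longrightarrow> Q s' \<Longrightarrow> Q' s'"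
  shows "runs W p s T' Q'"
  using assms exec_frame unfolding runs_def by (meson le_trans)

lemma runs_Seq:
  assumes "runs W p s T Q" "\<And>s'. frame p s s' \<Longrightarrow> Q s' \<Longrightarrow> runs W q s' T' Q'"
  shows "runs W (Seq p q) s (T + T') Q'"
proof -
  from assms(1) obtain t s' where 1: "exec W p s t s'" "t \<le> T" "Q s'" by (auto simp: runs_def)
  from assms(2)[OF exec_frame[OF 1(1)] 1(3)] obtain t' s'' where
    2: "exec W q s' t' s''" "t' \<le> T'" "Q' s''" by (auto simp: runs_def)
  from exec.Seq[OF 1(1) 2(1)] 1 2 show ?thesis unfolding runs_def by (meson add_mono)
qed

text \<open>Loop-free code is executed symbolically: \<open>result\<close> is its final state, and \<open>fits\<close> excludes
  loops and overflow.\<close>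

primrec result :: "prog \<Rightarrow> state \<Rightarrow> state" where
  "result Skip s = s"
| "result (SetConst r n) s = set_reg r n s"
| "result (Move r q) s = set_reg r (reg s q) s"
| "result (Add r q p) s = set_reg r (reg s q + reg s p) s"
| "result (Sub r q p) s = set_reg r (reg s q - reg s p) s"
| "result (Load r a q) s = set_reg r (arr s a (reg s q)) s"
| "result (Store a q r) s = set_arr a (reg s q) (reg s r) s"
| "result (Seq c d) s = result d (result c s)"
| "result (Cond b c d) s = (if holds b s then result c s else result d s)"
| "result (While b c) s = s"

primrec fits :: "nat \<Rightarrow> prog \<Rightarrow> state \<Rightarrow> bool" where
  "fits W Skip s \<longleftrightarrow> True"
| "fits W (SetConst r n) s \<longleftrightarrow> n < W"
| "fits W (Move r q) s \<longleftrightarrow> True"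
| "fits W (Add r q p) s \<longleftrightarrow> reg s q + reg s p < W"
| "fits W (Sub r q p) s \<longleftrightarrow> True"
| "fits W (Load r a q) s \<longleftrightarrow> True"
| "fits W (Store a q r) s \<longleftrightarrow> True"
| "fits W (Seq c d) s \<longleftrightarrow> fits W c s \<and> fits W d (result c s)"
| "fits W (Cond b c d) s \<longleftrightarrow> (if holds b s then fits W c s else fits W d s)"
| "fits W (While b c) s \<longleftrightarrow> False"

primrec cost :: "prog \<Rightarrow> nat" where
  "cost Skip = 1"
| "cost (SetConst r n) = 1"
| "cost (Move r q) = 1"
| "cost (Add r q p) = 1"
| "cost (Sub r q p) = 1"
| "cost (Load r a q) = 1"
| "cost (Store a q r) = 1"
| "cost (Seq c d) = cost c + cost d"
| "cost (Cond b c d) = cost c + cost d + 1"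
| "cost (While b c) = 0"

lemma exec_result: "fits W p s \<Longrightarrow> \<exists>t\<le>cost p. exec W p s t (result p s)"
proof (induction p arbitrary: s)
  case (Seq c d)
  then obtain t t' where "t \<le> cost c" "exec W c s t (result c s)"
    "t' \<le> cost d" "exec W d (result c s) t' (result d (result c s))" by force
  then show ?case using exec.Seq by (intro exI[of _ "t + t'"]) auto
next
  case (Cond b c d)
  show ?case
  proof (cases "holds b s")
    case True
    then obtain t where "t \<le> cost c" "exec W c s t (result c s)" using Cond by force
    then show ?thesis using True exec.CondTrue[of b s W c t "result c s" d]
      by (intro exI[of _ "t + 1"]) simp
  next
    case False
    then obtain t where "t \<le> cost d" "exec W d s t (result d s)" using Cond by force
    then show ?thesis using False exec.CondFalse[of b s W d t "result d s" c]
      by (intro exI[of _ "t + 1"]) simp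
  qed
qed (auto simp del: One_nat_def intro!: exI[of _ 1] exec.intros)

lemma runs_result: "fits W p s \<Longrightarrow> Q (result p s) \<Longrightarrow> runs W p s (cost p) Q"
  using exec_result unfolding runs_def by blast

text \<open>The bound \<open>T j\<close> may vary with the iteration, which lets nested scans of
  adjacency lists be charged to the sum of the degrees. The frame hypothesis carries facts about
  unwritten registers and arrays from the start into every iteration.\<close>

lemma runs_While:
  assumes body: "\<And>j s'. j < m \<Longrightarrow> frame body s s' \<Longrightarrow> reg s' i = j \<Longrightarrow> Inv j s' \<Longrightarrow>
      runs W body s' (T j) (\<lambda>s''. reg s'' i = Suc j \<and> Inv (Suc j) s'')"
    and e: "reg s e = m" "e \<notin> written_regs body" and init: "reg s i = 0" "Inv 0 s"
  shows "runs W (While (Less i e) body) s ((\<Sum>j<m. T j + 1) + 1) (Inv m)"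
proof -
  \<comment> \<open>Induction on the number \<open>k\<close> of iterations still to run, with
    counter value \<open>m - k\<close>.\<close>
  have "runs W (While (Less i e) body) s' ((\<Sum>j=m-k..<m. T j + 1) + 1) (Inv m)"
    if "k \<le> m" "frame body s s'" "reg s' i = m - k" "Inv (m - k) s'" for k s'
    using that
  proof (induction k arbitrary: s')
    case 0
    then have "\<not> holds (Less i e) s'" using e frame_reg by auto
    from exec.WhileFalse[OF this] show ?case using 0 unfolding runs_def by (intro exI[of _ 1] exI[of _ s']) simp
  next
    case (Suc k)
    have j: "m - Suc k < m" "Suc (m - Suc k) = m - k" using Suc.prems by auto
    have h: "holds (Less i e) s'" using Suc.prems e frame_reg j by auto
    obtain t s1 where 1: "exec W body s' t s1" "t \<le> T (m - Suc k)" "reg s1 i = m - k" "Inv (m - k) s1"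
      using body[OF j(1) Suc.prems(2-4)] j(2) by (auto simp: runs_def)
    have "frame body s s1" using frame_trans Suc.prems(2) exec_frame[OF 1(1)] by blast
    then obtain t' s2 where 2: "exec W (While (Less i e) body) s1 t' s2"
      "t' \<le> (\<Sum>j=m-k..<m. T j + 1) + 1" "Inv m s2"
      using Suc.IH[of s1] 1 Suc.prems(1) by (auto simp: runs_def)
    have "(\<Sum>j=m-Suc k..<m. T j + 1) = T (m - Suc k) + 1 + (\<Sum>j=m-k..<m. T j + 1)"
      using sum.atLeast_Suc_lessThan[OF j(1)] j(2) by metis
    then have "t + t' + 1 \<le> (\<Sum>j=m-Suc k..<m. T j + 1) + 1" using 1(2) 2(2) by linarith
    then show ?case using exec.WhileTrue[OF h 1(1) 2(1)] 2(3) unfolding runs_def by blast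
  qed
  from this[of m s] show ?thesis using init frame_refl by (simp add: lessThan_atLeast0)
qed

text \<open>Registers 2 and 3 hold the constants 1 and 0.\<close>

definition for_loop :: "nat \<Rightarrow> nat \<Rightarrow> prog \<Rightarrow> prog" where
  "for_loop i e body = Seq (Move i 3) (While (Less i e) (Seq body (Add i i 2)))"

lemma written_for_loop [simp]:
  "written_regs (for_loop i e body) = insert i (written_regs body)"
  "written_arrs (for_loop i e body) = written_arrs body"
  by (auto simp: for_loop_def)

text \<open>The 2 extra steps per iteration pay for the loop test and the increment; the final 2 pay
  for clearing the counter and the failing test. The invariant is demanded with the counter already
  advanced, so only \<open>body\<close> itself has to be analysed.\<close>

lemma runs_for_loop:
  assumes regs: "reg s 2 = 1" "reg s 3 = 0" "reg s e = m" "m < W"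
    and unwritten: "{2, 3, e} \<inter> insert i (written_regs body) = {}" "i \<notin> written_regs body"
    and init: "Inv 0 (set_reg i 0 s)"
    and body: "\<And>j s'. j < m \<Longrightarrow> frame (for_loop i e body) s s' \<Longrightarrow> reg s' i = j \<Longrightarrow> Inv j s' \<Longrightarrow>
      runs W body s' (T j) (\<lambda>s''. Inv (Suc j) (set_reg i (Suc j) s''))"
  shows "runs W (for_loop i e body) s ((\<Sum>j<m. T j + 2) + 2) (Inv m)"
proof -
  let ?s = "set_reg i 0 s" and ?b = "Seq body (Add i i 2)"
  have "runs W (While (Less i e) ?b) ?s ((\<Sum>j<m. (T j + 1) + 1) + 1) (Inv m)"
  proof (rule runs_While[where i = i and e = e])
    fix j s' assume j: "j < m" "frame ?b ?s s'" "reg s' i = j" "Inv j s'"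
    have "frame (for_loop i e body) s s'" using j(2) by (auto simp: frame_def for_loop_def)
    then have 1: "runs W body s' (T j) (\<lambda>s''. Inv (Suc j) (set_reg i (Suc j) s''))"
      using body j by blast
    have "runs W (Add i i 2) s'' 1 (\<lambda>s''. reg s'' i = Suc j \<and> Inv (Suc j) s'')"
      if "frame body s' s''" "Inv (Suc j) (set_reg i (Suc j) s'')" for s''
    proof -
      have "reg s'' i = j" "reg s'' 2 = 1"
        using that(1) j unwritten regs by (auto simp: frame_def)
      then show ?thesis using runs_result[of W "Add i i 2" s''] that(2) j(1) regs(4) by simp
    qed
    from runs_Seq[OF 1 this] show "runs W ?b s' (T j + 1) (\<lambda>s''. reg s'' i = Suc j \<and> Inv (Suc j) s'')" .
  qed (use regs unwritten init in auto)
  moreover have "runs W (Move i 3) s 1 (\<lambda>s'. s' = ?s)"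
    using runs_result[of W "Move i 3" s] regs by simp
  ultimately have "runs W (for_loop i e body) s (1 + ((\<Sum>j<m. (T j + 1) + 1) + 1)) (Inv m)"
    unfolding for_loop_def by (intro runs_Seq[where Q = "\<lambda>s'. s' = ?s"]) auto
  then show ?thesis by (rule runs_mono) simp_all
qed

lemma runs_for_loop_simple:
  assumes "reg s 2 = 1" "reg s 3 = 0" "reg s e = m" "m < W"
    and "{2, 3, e} \<inter> insert i (written_regs body) = {}" "i \<notin> written_regs body"
    and "Inv 0 (set_reg i 0 s)"
    and body: "\<And>j s'. j < m \<Longrightarrow> frame (for_loop i e body) s s' \<Longrightarrow> reg s' i = j \<Longrightarrow> Inv j s' \<Longrightarrow>
      fits W body s' \<and> Inv (Suc j) (set_reg i (Suc j) (result body s'))"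
  shows "runs W (for_loop i e body) s (m * (cost body + 2) + 2) (Inv m)"
proof -
  have "runs W (for_loop i e body) s ((\<Sum>j<m. cost body + 2) + 2) (Inv m)"
    by (rule runs_for_loop) (use assms runs_result in auto)
  then show ?thesis by simp
qed

section \<open>The decision program\<close>

abbreviation (input) seq (infixr ";;" 60) where "p ;; q \<equiv> Seq p q"

text \<open>After the run, \<open>aClq\<close> and \<open>aFor\<close> are the characteristic functions of the clique and of the
  forced vertices, \<open>aBlk\<close> is the block number, \<open>aNum\<close> counts the clique vertices by block (first per
  block, then cumulatively), and \<open>aFrt\<close> holds 1 plus the early vertex found to precede a clique
  vertex of the block, or 0 if there is none so far.\<close>

abbreviation (input) "rN \<equiv> 0 :: nat"
abbreviation (input) "rM \<equiv> 1 :: nat"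
abbreviation (input) "rOne \<equiv> 2 :: nat"
abbreviation (input) "rZero \<equiv> 3 :: nat"
abbreviation (input) "rI \<equiv> 4 :: nat"
abbreviation (input) "rLen \<equiv> 5 :: nat"
abbreviation (input) "rJ \<equiv> 6 :: nat"
abbreviation (input) "rX \<equiv> 7 :: nat"
abbreviation (input) "rY \<equiv> 8 :: nat"
abbreviation (input) "rT \<equiv> 9 :: nat"
abbreviation (input) "rU \<equiv> 10 :: nat"
abbreviation (input) "rB \<equiv> 11 :: nat"
abbreviation (input) "rAcc \<equiv> 12 :: nat"
abbreviation (input) "rK \<equiv> 13 :: nat"
abbreviation (input) "rRem \<equiv> 14 :: nat"
abbreviation (input) "rBad \<equiv> 15 :: nat"
abbreviation (input) "aOff \<equiv> 0 :: nat"
abbreviation (input) "aAdj \<equiv> 1 :: nat"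
abbreviation (input) "aFst \<equiv> 2 :: nat"
abbreviation (input) "aSnd \<equiv> 3 :: nat"
abbreviation (input) "aDeg \<equiv> 4 :: nat"
abbreviation (input) "aCnt \<equiv> 5 :: nat"
abbreviation (input) "aClq \<equiv> 6 :: nat"
abbreviation (input) "aFor \<equiv> 7 :: nat"
abbreviation (input) "aBlk \<equiv> 8 :: nat"
abbreviation (input) "aNum \<equiv> 9 :: nat"
abbreviation (input) "aFrt \<equiv> 10 :: nat"

definition degree_body :: prog where
  "degree_body =
     Load rX aOff rI ;; Add rT rI rOne ;; Load rY aOff rT ;; Sub rY rY rX ;; Store aDeg rI rY ;;
     Load rU aCnt rY ;; Add rU rU rOne ;; Store aCnt rY rU"

text \<open>Candidate sizes are tried downwards from the number of vertices; on entry
  \<open>rAcc\<close> counts the vertices of degree at least the candidate. \<open>rK = 0\<close>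
  means that no size has succeeded yet, and \<open>rRem\<close> is the number of vertices of degree
  \<open>k - 1\<close> to be added for the size \<open>k\<close> found.\<close>

definition clique_size_body :: prog where
  "clique_size_body =
     Sub rT rN rI ;; Sub rU rT rOne ;; Load rU aCnt rU ;; Add rU rAcc rU ;;
     Cond (Equal rK rZero)
       (Cond (Less rU rT) Skip (Move rK rT ;; Sub rRem rT rAcc))
       Skip ;;
     Move rAcc rU"

definition clique_body :: prog where
  "clique_body =
     Load rX aDeg rI ;;
     Cond (Less rX rK)
       (Add rX rX rOne ;;
        Cond (Equal rX rK)
          (Cond (Less rZero rRem) (Store aClq rI rOne ;; Sub rRem rRem rOne) Skip)
          Skip)
       (Store aClq rI rOne)"

definition forced_body :: prog where
  "forced_body =
     Load rX aFst rI ;; Load rY aSnd rI ;; Load rT aClq rX ;;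
     Cond (Equal rT rZero)
       (Load rT aClq rY ;;
        Cond (Equal rT rOne)
          (Store aFor rX rOne)
          (Load rT aDeg rX ;; Load rU aDeg rY ;;
           Cond (Less rT rU) (Store aFor rX rOne) Skip))
       Skip"

definition block_init_body :: prog where
  "block_init_body =
     Load rT aClq rI ;;
     Cond (Equal rT rOne)
       (Store aBlk rI rN)
       (Load rT aFor rI ;;
        Cond (Equal rT rOne)
          (Load rT aDeg rI ;; Store aBlk rI rT)
          (Add rT rN rOne ;; Store aBlk rI rT))"

definition block_edge_body :: prog where
  "block_edge_body =
     Add rT rB rJ ;; Load rT aAdj rT ;; Load rY aBlk rT ;;
     Cond (Less rU rY) (Store aBlk rT rU) Skip"

text \<open>Length 0 makes the following edge scan empty for a vertex that is not forced.\<close>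

definition block_pre :: prog where
  "block_pre =
     Load rU aDeg rI ;; Load rB aOff rI ;; Load rT aFor rI ;;
     Cond (Equal rT rOne) (Move rLen rU) (Move rLen rZero)"

definition block_body :: prog where
  "block_body = block_pre ;; for_loop rJ rLen block_edge_body"

definition count_body :: prog where
  "count_body =
     Load rT aClq rI ;;
     Cond (Equal rT rOne)
       (Load rX aBlk rI ;; Load rU aNum rX ;; Add rU rU rOne ;; Store aNum rX rU)
       Skip"

definition prefix_body :: prog where
  "prefix_body = Load rU aNum rI ;; Add rAcc rAcc rU ;; Store aNum rI rAcc"

definition chain_body :: prog where
  "chain_body =
     Load rT aFor rI ;;
     Cond (Equal rT rOne)
       (Load rU aDeg rI ;; Load rY aNum rU ;; Cond (Equal rU rY) Skip (Move rBad rOne))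
       Skip"

definition pair_body :: prog where
  "pair_body =
     Load rX aFst rI ;; Load rY aSnd rI ;; Load rT aBlk rX ;; Load rU aBlk rY ;;
     Cond (Less rU rT)
       (Move rBad rOne)
       (Cond (Equal rT rU)
          (Load rB aFor rX ;;
           Cond (Equal rB rOne)
             (Load rB aClq rY ;;
              Cond (Equal rB rOne)
                (Add rX rX rOne ;; Load rB aFrt rT ;;
                 Cond (Equal rB rZero)
                   (Store aFrt rT rX)
                   (Cond (Equal rB rX) Skip (Move rBad rOne)))
                Skip)
             Skip)
          Skip)"

definition find_clique :: prog where
  "find_clique =
     SetConst rOne 1 ;;
     for_loop rI rN degree_body ;;
     for_loop rI rN clique_size_body ;;
     for_loop rI rN clique_body"

text \<open>\<open>rAcc\<close> still holds a count from the search for the clique size and is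
  cleared before the prefix sums. The answer is 1 minus the failure flag and overwrites
  \<open>rN\<close>.\<close>

definition check_order :: prog where
  "check_order =
     for_loop rI rM forced_body ;;
     for_loop rI rN block_init_body ;;
     for_loop rI rN block_body ;;
     for_loop rI rN count_body ;;
     Move rAcc rZero ;;
     for_loop rI rN prefix_body ;;
     for_loop rI rN chain_body ;;
     for_loop rI rM pair_body ;;
     Sub rN rOne rBad"

lemmas body_defs = degree_body_def clique_size_body_def clique_body_def forced_body_def
  block_init_body_def block_edge_body_def block_pre_def block_body_def count_body_def
  prefix_body_def chain_body_def pair_body_def

section \<open>Correctness and cost of the scans that find the clique\<close>

locale input_lists =
  fixes adj :: "nat list list" and ps :: "(nat \<times> nat) list" and W :: nat
  assumes adj_less: "v < length adj \<Longrightarrow> set (adj ! v) \<subseteq> {..<length adj}"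
    and deg_less_length: "v < length adj \<Longrightarrow> length (adj ! v) < length adj"
    and ps_less: "(x, y) \<in> set ps \<Longrightarrow> x < length adj \<and> y < length adj"
    and ps_fit: "length ps < W" and adj_fit: "length (concat adj) < W"
    and size_fits: "length adj + 1 < W"
begin

abbreviation "n \<equiv> length adj"
abbreviation "m \<equiv> length ps"
abbreviation "D v \<equiv> length (adj ! v)"
abbreviation "off v \<equiv> length (concat (take v adj))"

definition loaded :: "state \<Rightarrow> bool" where
  "loaded s \<longleftrightarrow> reg s 0 = n \<and> reg s 1 = m \<and> reg s 2 = 1 \<and> reg s 3 = 0 \<and>
     (\<forall>v\<le>n. arr s 0 v = off v) \<and> (\<forall>v<n. \<forall>j<D v. arr s 1 (off v + j) = adj ! v ! j) \<and>
     (\<forall>j<m. arr s 2 j = fst (ps ! j) \<and> arr s 3 j = snd (ps ! j))"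

lemma loaded_frame:
  "loaded s \<Longrightarrow> frame p s s' \<Longrightarrow> {0, 1, 2, 3} \<inter> written_regs p = {} \<Longrightarrow>
     {0, 1, 2, 3} \<inter> written_arrs p = {} \<Longrightarrow> loaded s'"
  by (auto simp: loaded_def frame_def)

lemma loadedD:
  assumes "loaded s"
  shows "reg s 0 = n" "reg s 1 = m" "reg s (Suc 0) = m" "reg s 2 = 1" "reg s 3 = 0"
    "v \<le> n \<Longrightarrow> arr s 0 v = off v" "v < n \<Longrightarrow> j < D v \<Longrightarrow> arr s (Suc 0) (off v + j) = adj ! v ! j"
    "i < m \<Longrightarrow> arr s 2 i = fst (ps ! i)" "i < m \<Longrightarrow> arr s 3 i = snd (ps ! i)"
  using assms by (auto simp: loaded_def)

lemma off_Suc: "v < n \<Longrightarrow> off (Suc v) = off v + D v"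
  by (simp add: take_Suc_conv_app_nth)

lemma off_le: "v \<le> n \<Longrightarrow> off v \<le> length (concat adj)"
  by (metis append_take_drop_id concat_append length_append le_add1)

lemma card_Suc_filter:
  "card {v. v < Suc j \<and> P v} = card {v. v < j \<and> P v} + of_bool (P j)"
proof -
  have "{v. v < Suc j \<and> P v} = (if P j then insert j {v. v < j \<and> P v} else {v. v < j \<and> P v})"
    by (auto simp: less_Suc_eq)
  then show ?thesis by simp
qed

lemma card_filter_le: "card {v. v < j \<and> P v} \<le> j"
  using card_mono[of "{..<j}" "{v. v < j \<and> P v}"] by auto

definition ge :: "nat \<Rightarrow> nat" where
  "ge d = card {v. v < n \<and> d \<le> D v}"

definition degs :: "state \<Rightarrow> bool" where
  "degs s \<longleftrightarrow> (\<forall>v<n. arr s 4 v = D v)"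

lemma degree_loop:
  assumes s: "loaded s" "arr s 5 = (\<lambda>_. 0)"
  shows "runs W (for_loop 4 0 degree_body) s (n * (cost degree_body + 2) + 2)
    (\<lambda>s. degs s \<and> (\<forall>d. arr s 5 d = card {v. v < n \<and> D v = d}))"
  unfolding degs_def
proof (rule runs_for_loop_simple)
  fix j s' assume j: "j < n" and fr: "frame (for_loop 4 0 degree_body) s s'" and i: "reg s' 4 = j"
    and inv: "(\<forall>v<j. arr s' 4 v = D v) \<and> (\<forall>d. arr s' 5 d = card {v. v < j \<and> D v = d})"
  have l: "loaded s'" by (rule loaded_frame[OF s(1) fr]) (auto simp: body_defs)
  \<comment> \<open>Keeps the incremented counter below the word bound.\<close>
  have "card {v. v < j \<and> D v = D j} \<le> j" by (rule card_filter_le)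
  then show "fits W degree_body s' \<and>
      (\<forall>v<Suc j. arr (set_reg 4 (Suc j) (result degree_body s')) 4 v = D v) \<and>
      (\<forall>d. arr (set_reg 4 (Suc j) (result degree_body s')) 5 d = card {v. v < Suc j \<and> D v = d})"
    using inv j i size_fits loadedD[OF l] off_Suc[OF j]
    by (auto simp: degree_body_def card_Suc_filter All_less_Suc)
qed (use s loadedD[OF s(1)] size_fits in \<open>auto simp: body_defs\<close>)

text \<open>For a split graph this is the clique number read off the degree sequence, in the form
  required by \<open>split_part_by_degree\<close>.\<close>

definition clique_number :: "nat \<Rightarrow> bool" where
  "clique_number k \<longleftrightarrow> 0 < k \<and> k \<le> ge (k - 1) \<and> (\<forall>i>k. ge (i - 1) < i)"

lemma ge_le: "ge d \<le> n"
  unfolding ge_def by (rule card_filter_le)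

lemma ge_step: "ge d = ge (Suc d) + card {v. v < n \<and> D v = d}"
proof -
  have "{v. v < n \<and> d \<le> D v} = {v. v < n \<and> Suc d \<le> D v} \<union> {v. v < n \<and> D v = d}" by auto
  then show ?thesis unfolding ge_def by (simp add: card_Un_disjoint disjoint_iff)
qed

lemma ge_n: "ge n = 0"
  using deg_less_length by (fastforce simp: ge_def)

text \<open>Size 1 succeeds in a nonempty graph, so some size is found. Failure of size
  \<open>k + 1\<close> gives \<open>ge k \<le> k\<close>, hence the truncated subtraction that
  computes register 14 is exact.\<close>

lemma clique_size_loop:
  assumes s: "loaded s" "\<And>d. arr s 5 d = card {v. v < n \<and> D v = d}"
    "reg s 12 = 0" "reg s 13 = 0" "reg s 14 = 0" and n: "0 < n"
  shows "runs W (for_loop 4 0 clique_size_body) s (n * (cost clique_size_body + 2) + 2)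
    (\<lambda>s. clique_number (reg s 13) \<and> reg s 14 + ge (reg s 13) = reg s 13)"
proof -
  \<comment> \<open>The middle conjunct says that all sizes above the size found, or above the next
    candidate if there is none, have failed.\<close>
  define Inv where "Inv j s \<longleftrightarrow> reg s 12 = ge (n - j) \<and>
    (\<forall>i. (if reg s 13 = 0 then n - j else reg s 13) < i \<longrightarrow> ge (i - 1) < i) \<and>
    (reg s 13 \<noteq> 0 \<longrightarrow> reg s 13 \<le> n \<and> reg s 13 \<le> ge (reg s 13 - 1) \<and> reg s 14 = reg s 13 - ge (reg s 13))"
    for j and s :: state
  have "runs W (for_loop 4 0 clique_size_body) s (n * (cost clique_size_body + 2) + 2) (Inv n)"
  proof (rule runs_for_loop_simple)
    fix j s' assume j: "j < n" and fr: "frame (for_loop 4 0 clique_size_body) s s'"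
      and i: "reg s' 4 = j" and inv: "Inv j s'"
    have l: "loaded s'" by (rule loaded_frame[OF s(1) fr]) (auto simp: body_defs)
    have a: "arr s' 5 = arr s 5" by (rule frame_arr[OF fr]) (auto simp: body_defs)
    define d where "d = n - Suc j"
    have d: "n - j = Suc d" "n - j - 1 = d" using j by (auto simp: d_def)
    have st: "ge (Suc d) + card {v. v < n \<and> D v = d} = ge d" using ge_step[of d] by simp
    have pos: "ge (i - Suc 0) < i"
      if "ge d < Suc d" "\<forall>i>n - reg s' 4. ge (i - Suc 0) < i" "d < i" for i
      using that d i by (cases "i = Suc d") auto
    show "fits W clique_size_body s' \<and>
      Inv (Suc j) (set_reg 4 (Suc j) (result clique_size_body s'))"
      using inv j i size_fits loadedD[OF l] ge_le[of d] st
      by (auto simp: clique_size_body_def Inv_def a s(2) d d_def[symmetric] intro: pos)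
  next
    show "Inv 0 (set_reg 4 0 s)" using s ge_n by (auto simp: Inv_def intro: le_less_trans[OF ge_le])
  qed (use s loadedD[OF s(1)] size_fits in \<open>auto simp: body_defs\<close>)
  then show ?thesis
  proof (rule runs_mono)
    fix s' assume inv: "Inv n s'"
    have all: "ge (i - 1) < i" if "(if reg s' 13 = 0 then 0 else reg s' 13) < i" for i
      using inv that by (simp add: Inv_def)
    have "reg s' 13 \<noteq> 0"
    proof
      assume "reg s' 13 = 0"
      then have "ge 0 < 1" using all[of 1] by simp
      then show False using n by (simp add: ge_def)
    qed
    moreover from this have "ge (reg s' 13) < Suc (reg s' 13)"
      using all[of "Suc (reg s' 13)"] by simp
    ultimately show "clique_number (reg s' 13) \<and> reg s' 14 + ge (reg s' 13) = reg s' 13"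
      using inv by (auto simp: Inv_def clique_number_def)
  qed simp
qed

text \<open>The greedy choice uses up its quota of vertices of degree \<open>k - 1\<close>: with
  quota left, \<open>S\<close> would contain all vertices of degree at least \<open>k - 1\<close>,
  hence at least \<open>k\<close> vertices, whereas the count of chosen vertices gives
  fewer.\<close>

lemma clique_loop:
  assumes s: "loaded s" "degs s" "arr s 6 = (\<lambda>_. 0)"
    and k: "clique_number (reg s 13)" "reg s 14 + ge (reg s 13) = reg s 13"
  shows "runs W (for_loop 4 0 clique_body) s (n * (cost clique_body + 2) + 2)
    (\<lambda>s'. \<exists>S. arr s' 6 = (\<lambda>v. of_bool (v \<in> S)) \<and> {v. v < n \<and> reg s 13 \<le> D v} \<subseteq> S \<and>
       S \<subseteq> {v. v < n \<and> reg s 13 \<le> D v + 1} \<and> card S = reg s 13)"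
proof -
  let ?k = "reg s 13"
  define Inv where "Inv j s' \<longleftrightarrow> (\<exists>S. arr s' 6 = (\<lambda>v. of_bool (v \<in> S)) \<and> {v. v < j \<and> ?k \<le> D v} \<subseteq> S \<and>
    S \<subseteq> {v. v < j \<and> ?k \<le> D v + 1} \<and> reg s' 14 + card {v\<in>S. D v < ?k} = reg s 14 \<and>
    (reg s' 14 = 0 \<or> {v. v < j \<and> ?k \<le> D v + 1} \<subseteq> S))" for j and s' :: state
  have "runs W (for_loop 4 0 clique_body) s (n * (cost clique_body + 2) + 2) (Inv n)"
  proof (rule runs_for_loop_simple)
    fix j s' assume j: "j < n" and fr: "frame (for_loop 4 0 clique_body) s s'"
      and i: "reg s' 4 = j" and inv: "Inv j s'"
    have l: "loaded s'" by (rule loaded_frame[OF s(1) fr]) (auto simp: body_defs)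
    have a: "arr s' 4 = arr s 4" by (rule frame_arr[OF fr]) (auto simp: body_defs)
    have b: "reg s' 13 = reg s 13" by (rule frame_reg[OF fr]) (auto simp: body_defs)
    have dj: "arr s 4 j = D j" "D j < n" using s j deg_less_length by (auto simp: degs_def)
    from inv obtain S where S: "arr s' 6 = (\<lambda>v. of_bool (v \<in> S))" "{v. v < j \<and> ?k \<le> D v} \<subseteq> S"
      "S \<subseteq> {v. v < j \<and> ?k \<le> D v + 1}" "reg s' 14 + card {v\<in>S. D v < ?k} = reg s 14"
      "reg s' 14 = 0 \<or> {v. v < j \<and> ?k \<le> D v + 1} \<subseteq> S" unfolding Inv_def by blast
    have jS: "j \<notin> S" and fS: "finite S" using S(3) finite_subset[OF S(3)] by auto
    have ins: "{v \<in> insert j S. D v < ?k} = (if D j < ?k then insert j {v\<in>S. D v < ?k} else {v\<in>S. D v < ?k})"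
      by auto
    have card_ins: "card {v \<in> insert j S. D v < ?k} = card {v\<in>S. D v < ?k} + of_bool (D j < ?k)"
      unfolding ins using jS fS by simp
    have fit: "fits W clique_body s'"
      using loadedD[OF l] size_fits i dj by (auto simp: clique_body_def a b)
    consider "?k \<le> D j \<or> D j + 1 = ?k \<and> 0 < reg s' 14" | "D j + 1 < ?k \<or> D j + 1 = ?k \<and> reg s' 14 = 0"
      by linarith
    then have "Inv (Suc j) (set_reg 4 (Suc j) (result clique_body s'))"
    proof cases
      case 1
      have arr: "arr (set_reg 4 (Suc j) (result clique_body s')) 6 = (\<lambda>v. of_bool (v \<in> insert j S))"
        using 1 loadedD[OF l] i dj S(1) by (auto simp: clique_body_def a b fun_eq_iff)
      have r: "reg (set_reg 4 (Suc j) (result clique_body s')) 14 = reg s' 14 - of_bool (D j < ?k)"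
        using 1 loadedD[OF l] i dj by (auto simp: clique_body_def a b)
      have "reg (set_reg 4 (Suc j) (result clique_body s')) 14 + card {v \<in> insert j S. D v < ?k} = reg s 14"
        using S(4) 1 unfolding r card_ins by (auto simp: of_bool_def)
      moreover have "{v. v < Suc j \<and> ?k \<le> D v} \<subseteq> insert j S" "insert j S \<subseteq> {v. v < Suc j \<and> ?k \<le> D v + 1}"
        using S(2,3) 1 by (auto simp: less_Suc_eq)
      moreover have "reg (set_reg 4 (Suc j) (result clique_body s')) 14 = 0 \<or>
          {v. v < Suc j \<and> ?k \<le> D v + 1} \<subseteq> insert j S"
        using S(5) unfolding r by (auto simp: less_Suc_eq)
      ultimately show ?thesis unfolding Inv_def using arr by (intro exI[of _ "insert j S"] conjI)
    next
      case 2
      have "arr (set_reg 4 (Suc j) (result clique_body s')) 6 = (\<lambda>v. of_bool (v \<in> S))"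
        using 2 loadedD[OF l] i dj S(1) by (auto simp: clique_body_def a b fun_eq_iff)
      moreover have "reg (set_reg 4 (Suc j) (result clique_body s')) 14 = reg s' 14"
        using 2 loadedD[OF l] i dj by (auto simp: clique_body_def a b)
      ultimately show ?thesis unfolding Inv_def
        using S 2 by (intro exI[of _ S]) (auto simp: less_Suc_eq)
    qed
    with fit show "fits W clique_body s' \<and> Inv (Suc j) (set_reg 4 (Suc j) (result clique_body s'))" ..
  next
    show "Inv 0 (set_reg 4 0 s)" using s by (auto simp: Inv_def intro!: exI[of _ "{}"])
  qed (use s loadedD[OF s(1)] size_fits in \<open>auto simp: body_defs\<close>)
  then show ?thesis
  proof (rule runs_mono)
    fix s' assume "Inv n s'"
    then obtain S where S: "arr s' 6 = (\<lambda>v. of_bool (v \<in> S))" "{v. v < n \<and> ?k \<le> D v} \<subseteq> S"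
      "S \<subseteq> {v. v < n \<and> ?k \<le> D v + 1}" "reg s' 14 + card {v\<in>S. D v < ?k} = reg s 14"
      "reg s' 14 = 0 \<or> {v. v < n \<and> ?k \<le> D v + 1} \<subseteq> S" unfolding Inv_def by blast
    have fS: "finite S" using finite_subset[OF S(3)] by simp
    have "{v. v < n \<and> ?k \<le> D v} \<union> {v\<in>S. D v < ?k} = S" using S(2,3) by auto
    then have "card S = card ({v. v < n \<and> ?k \<le> D v} \<union> {v\<in>S. D v < ?k})" by simp
    also have "\<dots> = ge ?k + card {v\<in>S. D v < ?k}"
      unfolding ge_def using fS by (intro card_Un_disjoint) auto
    finally have c: "card S = ge ?k + card {v\<in>S. D v < ?k}" .
    have "reg s' 14 = 0"
    proof (rule ccontr)
      assume pos: "reg s' 14 \<noteq> 0"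
      have "{v. v < n \<and> ?k - 1 \<le> D v} = {v. v < n \<and> ?k \<le> D v + 1}" by auto
      moreover have "{v. v < n \<and> ?k \<le> D v + 1} \<subseteq> S" using pos S(5) by simp
      ultimately have "ge (?k - 1) \<le> card S" unfolding ge_def using card_mono[OF fS] by simp
      then show False using c S(4) k pos by (simp add: clique_number_def)
    qed
    then have "card S = ?k" using c S(4) k by simp
    then show "\<exists>S. arr s' 6 = (\<lambda>v. of_bool (v \<in> S)) \<and> {v. v < n \<and> ?k \<le> D v} \<subseteq> S \<and>
       S \<subseteq> {v. v < n \<and> ?k \<le> D v + 1} \<and> card S = ?k"
      using S(1-3) by (intro exI[of _ S] conjI)
  qed simp
qed

end

section \<open>Correctness and cost of the scans that test the order\<close>

locale split_input = input_lists +
  fixes S :: "nat set"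
  assumes S_sub: "S \<subseteq> {..<length adj}"
    and adj_other: "v < length adj \<Longrightarrow> v \<notin> S \<Longrightarrow> set (adj ! v) \<subseteq> S"
begin

lemma finS: "finite S"
  using S_sub finite_subset by blast

text \<open>The relation is a parameter so that the loop invariant can refer to the pairs read so
  far.\<close>

definition forced_by :: "(nat \<times> nat) set \<Rightarrow> nat set" where
  "forced_by T = {x. x \<notin> S \<and> (\<exists>y. (x, y) \<in> T \<and> (y \<in> S \<or> D x < D y))}"

abbreviation "F \<equiv> forced_by (set ps)"

lemma forced_by_insert:
  "forced_by (insert (x, y) T) =
     (if x \<notin> S \<and> (y \<in> S \<or> D x < D y) then insert x (forced_by T) else forced_by T)"
  by (auto simp: forced_by_def)

lemma F_less: "y \<in> F \<Longrightarrow> y < n"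
  using ps_less by (auto simp: forced_by_def)

lemma F_notin: "y \<in> F \<Longrightarrow> y \<notin> S"
  by (auto simp: forced_by_def)

lemma set_take_Suc: "j < length xs \<Longrightarrow> set (take (Suc j) xs) = insert (xs ! j) (set (take j xs))"
  by (simp add: take_Suc_conv_app_nth)

lemma forced_loop:
  assumes s: "loaded s" "degs s" "arr s 6 = (\<lambda>v. of_bool (v \<in> S))" "arr s 7 = (\<lambda>_. 0)"
  shows "runs W (for_loop 4 1 forced_body) s (m * (cost forced_body + 2) + 2)
    (\<lambda>s. arr s 7 = (\<lambda>v. of_bool (v \<in> F)))"
proof -
  define Inv where "Inv j s \<longleftrightarrow> arr s 7 = (\<lambda>v. of_bool (v \<in> forced_by (set (take j ps))))"
    for j and s :: state
  have "runs W (for_loop 4 1 forced_body) s (m * (cost forced_body + 2) + 2) (Inv m)"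
  proof (rule runs_for_loop_simple)
    fix j s' assume j: "j < m" and fr: "frame (for_loop 4 1 forced_body) s s'"
      and i: "reg s' 4 = j" and inv: "Inv j s'"
    have l: "loaded s'" by (rule loaded_frame[OF s(1) fr]) (auto simp: body_defs)
    have a: "arr s' 4 = arr s 4" "arr s' 6 = arr s 6"
      by (rule frame_arr[OF fr]; auto simp: body_defs)+
    obtain x y where xy: "ps ! j = (x, y)" by fastforce
    then have "x < n" "y < n" using ps_less nth_mem[OF j] by auto
    then have d: "arr s 4 x = D x" "arr s 4 y = D y" using s by (auto simp: degs_def)
    have T: "set (take (Suc j) ps) = insert (x, y) (set (take j ps))"
      using set_take_Suc[OF j] xy by simp
    show "fits W forced_body s' \<and> Inv (Suc j) (set_reg 4 (Suc j) (result forced_body s'))"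
      using inv i j loadedD[OF l] xy d s(3) unfolding Inv_def T forced_by_insert
      by (auto simp: forced_body_def a fun_eq_iff)
  next
    show "Inv 0 (set_reg 4 0 s)" using s by (auto simp: Inv_def forced_by_def)
  qed (use s loadedD[OF s(1)] ps_fit in \<open>auto simp: body_defs\<close>)
  then show ?thesis by (rule runs_mono) (auto simp: Inv_def)
qed

text \<open>\<open>Y\<close> stands for the forced vertices whose lists have been scanned. Only the
  minima on \<open>S\<close> vary with it; values outside \<open>S\<close> use the complete set
  \<open>F\<close> from the start.\<close>

definition block_of :: "nat set \<Rightarrow> nat \<Rightarrow> nat" where
  "block_of Y v = (if v \<in> S then Min (insert n (D ` {y\<in>Y. v \<in> set (adj ! y)}))
     else if v \<in> F then D v else n + 1)"

lemma block_of_insert: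
  assumes "finite Y"
  shows "block_of (insert y Y) v =
    (if v \<in> S \<and> v \<in> set (adj ! y) then min (D y) (block_of Y v) else block_of Y v)"
proof -
  have "{x \<in> insert y Y. v \<in> set (adj ! x)} =
      (if v \<in> set (adj ! y) then insert y {x\<in>Y. v \<in> set (adj ! x)} else {x\<in>Y. v \<in> set (adj ! x)})"
    by auto
  then show ?thesis using assms by (auto simp: block_of_def insert_commute[of n])
qed

lemma block_init_loop:
  assumes s: "loaded s" "degs s" "arr s 6 = (\<lambda>v. of_bool (v \<in> S))" "arr s 7 = (\<lambda>v. of_bool (v \<in> F))"
  shows "runs W (for_loop 4 0 block_init_body) s (n * (cost block_init_body + 2) + 2)
    (\<lambda>s. \<forall>v<n. arr s 8 v = block_of {} v)"
proof (rule runs_for_loop_simple)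
  fix j s' assume j: "j < n" and fr: "frame (for_loop 4 0 block_init_body) s s'"
    and i: "reg s' 4 = j" and inv: "\<forall>v<j. arr s' 8 v = block_of {} v"
  have l: "loaded s'" by (rule loaded_frame[OF s(1) fr]) (auto simp: body_defs)
  have a: "arr s' 4 = arr s 4" "arr s' 6 = arr s 6" "arr s' 7 = arr s 7"
    by (rule frame_arr[OF fr]; auto simp: body_defs)+
  have d: "arr s 4 j = D j" using s j by (auto simp: degs_def)
  show "fits W block_init_body s' \<and>
    (\<forall>v<Suc j. arr (set_reg 4 (Suc j) (result block_init_body s')) 8 v = block_of {} v)"
    using inv i j loadedD[OF l] d s(3,4) size_fits F_notin
    by (auto simp: block_init_body_def a All_less_Suc block_of_def)
qed (use s loadedD[OF s(1)] size_fits in \<open>auto simp: body_defs\<close>)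

text \<open>Neighbours of a forced vertex lie in \<open>S\<close>, so lowering their entries never
  damages a value outside \<open>S\<close>. The bound charges \<open>D y\<close> even when the scan
  is empty, which makes the total a plain degree sum.\<close>

lemma block_edge_loop:
  assumes s: "loaded s" "reg s 11 = off y" "reg s 10 = D y" "reg s 5 = (if y \<in> F then D y else 0)"
    and y: "y < n" and Y: "finite Y" "\<forall>v<n. arr s 8 v = block_of Y v"
  shows "runs W (for_loop 6 5 block_edge_body) s (D y * (cost block_edge_body + 2) + 2)
    (\<lambda>s. \<forall>v<n. arr s 8 v = block_of (if y \<in> F then insert y Y else Y) v)"
proof -
  let ?e = "if y \<in> F then D y else 0"
  define Inv where "Inv q s \<longleftrightarrow> (\<forall>v<n. arr s 8 v =
    (if v \<in> S \<and> v \<in> set (take q (adj ! y)) then min (D y) (block_of Y v) else block_of Y v))"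
    for q and s :: state
  have "runs W (for_loop 6 5 block_edge_body) s (?e * (cost block_edge_body + 2) + 2) (Inv ?e)"
  proof (rule runs_for_loop_simple)
    fix j s' assume j: "j < ?e" and fr: "frame (for_loop 6 5 block_edge_body) s s'"
      and i: "reg s' 6 = j" and inv: "Inv j s'"
    have yF: "y \<in> F" and jD: "j < D y" using j by (auto split: if_splits)
    have l: "loaded s'" by (rule loaded_frame[OF s(1) fr]) (auto simp: body_defs)
    have a: "reg s' 11 = reg s 11" "reg s' 10 = reg s 10"
      by (rule frame_reg[OF fr]; auto simp: body_defs)+
    have "off y + j < length (concat adj)"
      using off_le[of "Suc y"] off_Suc[OF y] y jD by simp
    then have fit: "off y + j < W" using adj_fit by simp
    have v: "adj ! y ! j \<in> S" "adj ! y ! j < n"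
      using adj_other[OF y F_notin[OF yF]] adj_less[OF y] nth_mem[OF jD] by auto
    have T: "set (take (Suc j) (adj ! y)) = insert (adj ! y ! j) (set (take j (adj ! y)))"
      by (rule set_take_Suc[OF jD])
    show "fits W block_edge_body s' \<and> Inv (Suc j) (set_reg 6 (Suc j) (result block_edge_body s'))"
      using inv i loadedD(1-5)[OF l] loadedD(7)[OF l y jD] v fit s unfolding Inv_def T
      by (auto simp: block_edge_body_def a min_def)
  qed (use s Y loadedD[OF s(1)] size_fits deg_less_length[OF y] in \<open>auto simp: body_defs Inv_def\<close>)
  then show ?thesis
    by (rule runs_mono) (auto simp: Inv_def block_of_insert[OF Y(1)])
qed

lemma block_loop:
  assumes s: "loaded s" "degs s" "arr s 7 = (\<lambda>v. of_bool (v \<in> F))" "\<forall>v<n. arr s 8 v = block_of {} v"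
  shows "runs W (for_loop 4 0 block_body) s
    (length (concat adj) * (cost block_edge_body + 2) + n * (cost block_pre + 4) + 2)
    (\<lambda>s. \<forall>v<n. arr s 8 v = block_of F v)"
proof -
  define Inv where "Inv j s \<longleftrightarrow> (\<forall>v<n. arr s 8 v = block_of {y\<in>F. y < j} v)" for j and s :: state
  have "runs W (for_loop 4 0 block_body) s
    ((\<Sum>j<n. (cost block_pre + (D j * (cost block_edge_body + 2) + 2)) + 2) + 2) (Inv n)"
  proof (rule runs_for_loop)
    fix j s' assume j: "j < n" and fr: "frame (for_loop 4 0 block_body) s s'"
      and i: "reg s' 4 = j" and inv: "Inv j s'"
    have l: "loaded s'" by (rule loaded_frame[OF s(1) fr]) (auto simp: body_defs)
    have a: "arr s' 4 = arr s 4" "arr s' 7 = arr s 7"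
      by (rule frame_arr[OF fr]; auto simp: body_defs)+
    have d: "arr s 4 j = D j" using s j by (auto simp: degs_def)
    have pre: "runs W block_pre s' (cost block_pre) (\<lambda>s. reg s 11 = off j \<and> reg s 10 = D j \<and>
        reg s 5 = (if j \<in> F then D j else 0) \<and> (\<forall>v<n. arr s 8 v = block_of {y\<in>F. y < j} v))"
      by (rule runs_result) (use inv loadedD[OF l] i d s j in \<open>auto simp: block_pre_def a Inv_def\<close>)
    have F_Suc: "{y\<in>F. y < Suc j} = (if j \<in> F then insert j {y\<in>F. y < j} else {y\<in>F. y < j})"
      by (auto simp: less_Suc_eq)
    show "runs W block_body s' (cost block_pre + (D j * (cost block_edge_body + 2) + 2))
       (\<lambda>s''. Inv (Suc j) (set_reg 4 (Suc j) s''))"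
      unfolding block_body_def
    proof (rule runs_Seq[OF pre])
      fix s2 assume fr2: "frame block_pre s' s2" and q: "reg s2 11 = off j \<and> reg s2 10 = D j \<and>
        reg s2 5 = (if j \<in> F then D j else 0) \<and> (\<forall>v<n. arr s2 8 v = block_of {y\<in>F. y < j} v)"
      have l2: "loaded s2" by (rule loaded_frame[OF l fr2]) (auto simp: body_defs)
      show "runs W (for_loop 6 5 block_edge_body) s2 (D j * (cost block_edge_body + 2) + 2)
        (\<lambda>s''. Inv (Suc j) (set_reg 4 (Suc j) s''))"
        using block_edge_loop[OF l2 _ _ _ j, of "{y\<in>F. y < j}"] q
        by (simp add: Inv_def F_Suc)
    qed
  next
    show "Inv 0 (set_reg 4 0 s)" using s by (auto simp: Inv_def)
  qed (use s loadedD[OF s(1)] size_fits in \<open>auto simp: body_defs\<close>)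
  \<comment> \<open>The inner scans together cost one pass over the edge array, which makes the
    nested loop linear.\<close>
  moreover have "(\<Sum>j<n. D j) = length (concat adj)"
    by (simp add: length_concat sum_list_sum_nth atLeast0LessThan)
  then have "(\<Sum>j<n. (cost block_pre + (D j * (cost block_edge_body + 2) + 2)) + 2) =
      length (concat adj) * (cost block_edge_body + 2) + n * (cost block_pre + 4)"
    by (simp only: sum.distrib sum_distrib_right[symmetric]) (simp add: algebra_simps)
  ultimately have "runs W (for_loop 4 0 block_body) s
    (length (concat adj) * (cost block_edge_body + 2) + n * (cost block_pre + 4) + 2) (Inv n)"
    by simp
  moreover have eq: "{y\<in>F. y < n} = F" using F_less by auto
  ultimately show ?thesis by (elim runs_mono) (simp_all only: Inv_def eq order_refl)
qed

abbreviation "B \<equiv> block_of F"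

lemma count_loop:
  assumes s: "loaded s" "arr s 6 = (\<lambda>v. of_bool (v \<in> S))" "\<forall>v<n. arr s 8 v = B v" "arr s 9 = (\<lambda>_. 0)"
  shows "runs W (for_loop 4 0 count_body) s (n * (cost count_body + 2) + 2)
    (\<lambda>s. \<forall>d. arr s 9 d = card {v\<in>S. B v = d})"
proof -
  define Inv where "Inv j s \<longleftrightarrow> (\<forall>d. arr s 9 d = card {v. v < j \<and> (v \<in> S \<and> B v = d)})" for j and s :: state
  have "runs W (for_loop 4 0 count_body) s (n * (cost count_body + 2) + 2) (Inv n)"
  proof (rule runs_for_loop_simple)
    fix j s' assume j: "j < n" and fr: "frame (for_loop 4 0 count_body) s s'"
      and i: "reg s' 4 = j" and inv: "Inv j s'"
    have l: "loaded s'" by (rule loaded_frame[OF s(1) fr]) (auto simp: body_defs)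
    have a: "arr s' 6 = arr s 6" "arr s' 8 = arr s 8"
      by (rule frame_arr[OF fr]; auto simp: body_defs)+
    have "card {v. v < j \<and> (v \<in> S \<and> B v = B j)} \<le> j" by (rule card_filter_le)
    then show "fits W count_body s' \<and> Inv (Suc j) (set_reg 4 (Suc j) (result count_body s'))"
      using inv i j loadedD[OF l] s size_fits
      by (auto simp: count_body_def a Inv_def card_Suc_filter)
  qed (use s loadedD[OF s(1)] size_fits in \<open>auto simp: body_defs Inv_def\<close>)
  moreover have eq: "{v. v < n \<and> (v \<in> S \<and> B v = d)} = {v\<in>S. B v = d}" for d using S_sub by auto
  ultimately show ?thesis by (elim runs_mono) (simp_all only: Inv_def eq order_refl simp_thms)
qed

lemma prefix_loop:
  assumes s: "loaded s" "\<forall>d. arr s 9 d = card {v\<in>S. B v = d}" "reg s 12 = 0"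
  shows "runs W (for_loop 4 0 prefix_body) s (n * (cost prefix_body + 2) + 2)
    (\<lambda>s. \<forall>d<n. arr s 9 d = card {v\<in>S. B v \<le> d})"
proof -
  define Inv where "Inv j s \<longleftrightarrow> reg s 12 = card {v\<in>S. B v < j} \<and>
    (\<forall>d<j. arr s 9 d = card {v\<in>S. B v \<le> d}) \<and> (\<forall>d\<ge>j. arr s 9 d = card {v\<in>S. B v = d})"
    for j and s :: state
  have "runs W (for_loop 4 0 prefix_body) s (n * (cost prefix_body + 2) + 2) (Inv n)"
  proof (rule runs_for_loop_simple)
    fix j s' assume j: "j < n" and fr: "frame (for_loop 4 0 prefix_body) s s'"
      and i: "reg s' 4 = j" and inv: "Inv j s'"
    have l: "loaded s'" by (rule loaded_frame[OF s(1) fr]) (auto simp: body_defs)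
    have "{v\<in>S. B v \<le> j} = {v\<in>S. B v < j} \<union> {v\<in>S. B v = j}" by auto
    then have c: "card {v\<in>S. B v \<le> j} = card {v\<in>S. B v < j} + card {v\<in>S. B v = j}"
      using finS by (simp add: card_Un_disjoint disjoint_iff)
    have le: "card {v\<in>S. B v \<le> j} \<le> n"
      using card_mono[of "{..<n}" "{v\<in>S. B v \<le> j}"] S_sub by auto
    show "fits W prefix_body s' \<and> Inv (Suc j) (set_reg 4 (Suc j) (result prefix_body s'))"
      using inv i j loadedD[OF l] c le size_fits
      by (auto simp: prefix_body_def Inv_def All_less_Suc less_Suc_eq_le)
  qed (use s loadedD[OF s(1)] size_fits in \<open>auto simp: body_defs Inv_def\<close>)
  then show ?thesis by (rule runs_mono) (auto simp: Inv_def)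
qed

text \<open>With the cumulative table, the first feasibility clause costs a single lookup per forced
  vertex.\<close>

lemma chain_loop:
  assumes s: "loaded s" "degs s" "arr s 7 = (\<lambda>v. of_bool (v \<in> F))"
    "\<forall>d<n. arr s 9 d = card {v\<in>S. B v \<le> d}" "reg s 15 = 0"
  shows "runs W (for_loop 4 0 chain_body) s (n * (cost chain_body + 2) + 2)
    (\<lambda>s. reg s 15 = of_bool (\<exists>y\<in>F. card {v\<in>S. B v \<le> D y} \<noteq> D y))"
proof -
  define Inv where "Inv j s \<longleftrightarrow>
    reg s 15 = of_bool (\<exists>y<j. y \<in> F \<and> card {v\<in>S. B v \<le> D y} \<noteq> D y)" for j and s :: state
  have "runs W (for_loop 4 0 chain_body) s (n * (cost chain_body + 2) + 2) (Inv n)"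
  proof (rule runs_for_loop_simple)
    fix j s' assume j: "j < n" and fr: "frame (for_loop 4 0 chain_body) s s'"
      and i: "reg s' 4 = j" and inv: "Inv j s'"
    have l: "loaded s'" by (rule loaded_frame[OF s(1) fr]) (auto simp: body_defs)
    have a: "arr s' 4 = arr s 4" "arr s' 7 = arr s 7" "arr s' 9 = arr s 9"
      by (rule frame_arr[OF fr]; auto simp: body_defs)+
    have d: "arr s 4 j = D j" "D j < n" using s j deg_less_length by (auto simp: degs_def)
    show "fits W chain_body s' \<and> Inv (Suc j) (set_reg 4 (Suc j) (result chain_body s'))"
      using inv i j loadedD[OF l] s d
      by (auto simp: chain_body_def a Inv_def Ex_less_Suc)
  qed (use s loadedD[OF s(1)] size_fits in \<open>auto simp: body_defs Inv_def\<close>)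
  moreover have eq: "(\<exists>y<n. y \<in> F \<and> card {v\<in>S. B v \<le> D y} \<noteq> D y) \<longleftrightarrow>
      (\<exists>y\<in>F. card {v\<in>S. B v \<le> D y} \<noteq> D y)" using F_less by auto
  ultimately show ?thesis by (elim runs_mono) (simp_all only: Inv_def eq order_refl)
qed

definition fronts :: "(nat \<times> nat) set \<Rightarrow> nat \<Rightarrow> nat set" where
  "fronts T d = {x\<in>F. B x = d \<and> (\<exists>v\<in>S. (x, v) \<in> T \<and> B v = d)}"

lemma fronts_insert:
  "fronts (insert (x, y) T) d =
     (if x \<in> F \<and> y \<in> S \<and> B x = d \<and> B y = d then insert x (fronts T d) else fronts T d)"
  by (auto simp: fronts_def)

text \<open>Failure of the second or third feasibility clause among the pairs in \<open>T\<close>;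
  as with \<open>forced_by\<close>, the parameter serves the loop invariant.\<close>

definition conflict :: "(nat \<times> nat) set \<Rightarrow> bool" where
  "conflict T \<longleftrightarrow> (\<exists>(x, y)\<in>T. B y < B x) \<or> (\<exists>d. \<exists>x\<in>fronts T d. \<exists>x'\<in>fronts T d. x \<noteq> x')"

text \<open>Remembering one front vertex per block suffices: if a block has two, then one that is
  read later differs from the remembered one, and the flag stays set once raised.\<close>

lemma pair_loop:
  assumes s: "loaded s" "arr s 6 = (\<lambda>v. of_bool (v \<in> S))" "arr s 7 = (\<lambda>v. of_bool (v \<in> F))"
    "\<forall>v<n. arr s 8 v = B v" "arr s 10 = (\<lambda>_. 0)" "reg s 15 = of_bool c"
  shows "runs W (for_loop 4 1 pair_body) s (m * (cost pair_body + 2) + 2)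
    (\<lambda>s. reg s 15 = of_bool (c \<or> conflict (set ps)))"
proof -
  define Inv where "Inv j s \<longleftrightarrow> reg s 15 = of_bool (c \<or> conflict (set (take j ps))) \<and>
    (\<forall>d. (arr s 10 d = 0 \<longrightarrow> fronts (set (take j ps)) d = {}) \<and>
      (arr s 10 d \<noteq> 0 \<longrightarrow> arr s 10 d - 1 \<in> fronts (set (take j ps)) d))" for j and s :: state
  have "runs W (for_loop 4 1 pair_body) s (m * (cost pair_body + 2) + 2) (Inv m)"
  proof (rule runs_for_loop_simple)
    fix j s' assume j: "j < m" and fr: "frame (for_loop 4 1 pair_body) s s'"
      and i: "reg s' 4 = j" and inv: "Inv j s'"
    have l: "loaded s'" by (rule loaded_frame[OF s(1) fr]) (auto simp: body_defs)
    have a: "arr s' 6 = arr s 6" "arr s' 7 = arr s 7" "arr s' 8 = arr s 8"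
      by (rule frame_arr[OF fr]; auto simp: body_defs)+
    obtain x y where xy: "ps ! j = (x, y)" by fastforce
    then have xyn: "x < n" "y < n" using ps_less nth_mem[OF j] by auto
    then have b: "arr s 8 x = B x" "arr s 8 y = B y" using s by auto
    define T where "T = set (take j ps)"
    have T: "set (take (Suc j) ps) = insert (x, y) T"
      using set_take_Suc[OF j] xy by (simp add: T_def)
    have inv1: "reg s' 15 = of_bool (c \<or> conflict T)"
      and inv2: "arr s' 10 d = 0 \<Longrightarrow> fronts T d = {}"
      and inv3: "arr s' 10 d \<noteq> 0 \<Longrightarrow> arr s' 10 d - 1 \<in> fronts T d" for d
      using inv by (auto simp: Inv_def T_def)
    note ev = loadedD(1-5)[OF l] loadedD(8,9)[OF l j] i xy b s(2,3) xyn size_fits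
    have fit: "fits W pair_body s'" using ev by (auto simp: pair_body_def a)
    consider (down) "B y < B x" | (none) "B x \<le> B y" "\<not> (x \<in> F \<and> y \<in> S \<and> B y = B x)"
      | (front) "x \<in> F" "y \<in> S" "B y = B x" by linarith
    then have "Inv (Suc j) (set_reg 4 (Suc j) (result pair_body s'))"
    proof cases
      case down
      have "arr (result pair_body s') 10 = arr s' 10" "reg (result pair_body s') 15 = 1"
        using ev down by (auto simp: pair_body_def a)
      moreover have "fronts (insert (x, y) T) = fronts T" using down by (intro ext) (auto simp: fronts_insert)
      moreover have "conflict (insert (x, y) T)" using down by (auto simp: conflict_def)
      ultimately show ?thesis using inv2 inv3 by (auto simp: Inv_def T)
    next
      case none
      have "arr (result pair_body s') 10 = arr s' 10" "reg (result pair_body s') 15 = reg s' 15"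
        using ev none by (auto simp: pair_body_def a)
      moreover have f: "fronts (insert (x, y) T) = fronts T" using none by (intro ext) (auto simp: fronts_insert)
      moreover have "conflict (insert (x, y) T) = conflict T"
        using none by (auto simp: conflict_def f)
      ultimately show ?thesis using inv1 inv2 inv3 by (auto simp: Inv_def T)
    next
      case front
      have f: "fronts (insert (x, y) T) = (fronts T)(B x := insert x (fronts T (B x)))"
        using front by (intro ext) (auto simp: fronts_insert)
      consider "arr s' 10 (B x) = 0" | "arr s' 10 (B x) = x + 1"
        | "arr s' 10 (B x) \<noteq> 0" "arr s' 10 (B x) \<noteq> x + 1" by blast
      then show ?thesis
      proof cases
        case 1
        have r: "arr (result pair_body s') 10 = (arr s' 10)(B x := x + 1)"
          "reg (result pair_body s') 15 = reg s' 15"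
          using ev front 1 by (auto simp: pair_body_def a)
        have "fronts T (B x) = {}" using inv2 1 by simp
        then have eq: "(\<exists>z\<in>fronts (insert (x, y) T) d. \<exists>z'\<in>fronts (insert (x, y) T) d. z \<noteq> z') \<longleftrightarrow>
            (\<exists>z\<in>fronts T d. \<exists>z'\<in>fronts T d. z \<noteq> z')" for d
          by (cases "d = B x") (auto simp: f)
        have "conflict (insert (x, y) T) = conflict T"
          using front unfolding conflict_def eq by simp
        then show ?thesis using inv1 inv2 inv3 r by (auto simp: Inv_def T f)
      next
        case 2
        have r: "arr (result pair_body s') 10 = arr s' 10"
          "reg (result pair_body s') 15 = reg s' 15"
          using ev front 2 by (auto simp: pair_body_def a)
        have "x \<in> fronts T (B x)" using inv3[of "B x"] 2 by simp
        then have f': "fronts (insert (x, y) T) = fronts T" by (simp add: f insert_absorb)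
        then have "conflict (insert (x, y) T) = conflict T"
          using front by (auto simp: conflict_def)
        then show ?thesis using inv1 inv2 inv3 r f' by (auto simp: Inv_def T)
      next
        case 3
        have r: "arr (result pair_body s') 10 = arr s' 10" "reg (result pair_body s') 15 = 1"
          using ev front 3 by (auto simp: pair_body_def a)
        \<comment> \<open>The remembered vertex is a front vertex of the same block and different
          from \<open>x\<close>; the two witness the conflict.\<close>
        have old: "arr s' 10 (B x) - 1 \<in> fronts T (B x)" using inv3 3 by simp
        then have "conflict (insert (x, y) T)" using 3
          unfolding conflict_def f by (intro disjI2 exI[of _ "B x"]) (auto intro!: bexI[OF _ old])
        then show ?thesis using inv2 inv3 r 3 by (auto simp: Inv_def T f)
      qed
    qed
    with fit show "fits W pair_body s' \<and> Inv (Suc j) (set_reg 4 (Suc j) (result pair_body s'))" ..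
  next
    show "Inv 0 (set_reg 4 0 s)" using s by (auto simp: Inv_def conflict_def fronts_def)
  qed (use s loadedD[OF s(1)] ps_fit in \<open>auto simp: body_defs\<close>)
  then show ?thesis by (rule runs_mono) (auto simp: Inv_def)
qed

end

section \<open>Composition of the scans\<close>

lemma nth_concat_take:
  assumes "v < length xss" "j < length (xss ! v)"
  shows "concat xss ! (length (concat (take v xss)) + j) = xss ! v ! j"
    and "length (concat (take v xss)) + j < length (concat xss)"
proof -
  have "concat xss = concat (take v xss) @ xss ! v @ concat (drop (Suc v) xss)"
    by (metis assms(1) concat.simps(2) concat_append id_take_nth_drop)
  then show "concat xss ! (length (concat (take v xss)) + j) = xss ! v ! j"
    and "length (concat (take v xss)) + j < length (concat xss)"
    using assms(2) by (simp_all add: nth_append)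
qed

context input_lists
begin

lemma loaded_input: "loaded (set_reg 2 1 (input_state adj ps))"
proof -
  have "offsets adj ! v = off v" if "v \<le> n" for v
    using that by (simp add: offsets_def del: upt_Suc)
  then show ?thesis
    using nth_concat_take[of _ adj]
    by (auto simp: loaded_def input_state_def array_of_def offsets_def simp del: upt_Suc)
qed

text \<open>The factor 100 is a round bound: the three loops together spend fewer than 100 steps per
  vertex.\<close>

lemma find_clique_runs:
  assumes n: "0 < n"
  shows "runs W find_clique (input_state adj ps) (100 * (n + 1))
    (\<lambda>s. loaded s \<and> degs s \<and> (\<forall>a>6. arr s a = (\<lambda>_. 0)) \<and> reg s 15 = 0 \<and>
      (\<exists>S k. arr s 6 = (\<lambda>v. of_bool (v \<in> S)) \<and> clique_number k \<and> {v. v < n \<and> k \<le> D v} \<subseteq> S \<and>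
       S \<subseteq> {v. v < n \<and> k \<le> D v + 1} \<and> card S = k))"
proof -
  let ?init = "input_state adj ps" and ?s = "set_reg 2 1 (input_state adj ps)"
  have e0: "exec W (SetConst 2 1) ?init 1 ?s" using size_fits by (intro exec.SetConst) simp
  have z0: "arr ?s a = (\<lambda>_. 0)" if "a > 3" for a using that by (auto simp: input_state_def)
  have r0: "reg ?s r = 0" if "r > 2" for r using that by (auto simp: input_state_def)
  obtain t1 s1 where e1: "exec W (for_loop 4 0 degree_body) ?s t1 s1"
      "t1 \<le> n * (cost degree_body + 2) + 2"
    and q1: "degs s1" "\<And>d. arr s1 5 d = card {v. v < n \<and> D v = d}"
    using degree_loop[OF loaded_input z0] by (auto simp: runs_def)
  note f1 = exec_frame[OF e1(1)]
  have l1: "loaded s1" by (rule loaded_frame[OF loaded_input f1]) (auto simp: body_defs)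
  have z1: "arr s1 a = (\<lambda>_. 0)" if "a > 5" for a
    using z0[of a] frame_arr[OF f1, of a] that by (auto simp: body_defs)
  have r1: "reg s1 r = 0" if "r > 11" for r
    using r0[of r] frame_reg[OF f1, of r] that by (auto simp: body_defs)
  obtain t2 s2 where e2: "exec W (for_loop 4 0 clique_size_body) s1 t2 s2"
      "t2 \<le> n * (cost clique_size_body + 2) + 2"
    and q2: "clique_number (reg s2 13)" "reg s2 14 + ge (reg s2 13) = reg s2 13"
    using clique_size_loop[OF l1 q1(2) r1 r1 r1 n] by (auto simp: runs_def)
  note f2 = exec_frame[OF e2(1)]
  have l2: "loaded s2" by (rule loaded_frame[OF l1 f2]) (auto simp: body_defs)
  have a2: "arr s2 a = arr s1 a" for a by (rule frame_arr[OF f2]) (auto simp: body_defs)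
  have r2: "reg s2 r = 0" if "r > 14" for r
    using r1[of r] frame_reg[OF f2, of r] that by (auto simp: body_defs)
  have d2: "degs s2" using q1(1) by (simp add: degs_def a2)
  obtain t3 s3 S where e3: "exec W (for_loop 4 0 clique_body) s2 t3 s3"
      "t3 \<le> n * (cost clique_body + 2) + 2"
    and q3: "arr s3 6 = (\<lambda>v. of_bool (v \<in> S))" "{v. v < n \<and> reg s2 13 \<le> D v} \<subseteq> S"
      "S \<subseteq> {v. v < n \<and> reg s2 13 \<le> D v + 1}" "card S = reg s2 13"
    using clique_loop[OF l2 d2 _ q2] z1[of 6] unfolding runs_def a2 by auto
  note f3 = exec_frame[OF e3(1)]
  have l3: "loaded s3" by (rule loaded_frame[OF l2 f3]) (auto simp: body_defs)
  have a3: "arr s3 a = arr s2 a" if "a \<noteq> 6" for a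
    by (rule frame_arr[OF f3]) (use that in \<open>auto simp: body_defs\<close>)
  have r3: "reg s3 15 = 0" using r2[of 15] frame_reg[OF f3, of 15] by (auto simp: body_defs)
  have d3: "degs s3" using d2 by (simp add: degs_def a3)
  have "exec W find_clique ?init (1 + (t1 + (t2 + t3))) s3"
    unfolding find_clique_def by (rule exec.Seq[OF e0 exec.Seq[OF e1(1) exec.Seq[OF e2(1) e3(1)]]])
  moreover have "1 + (t1 + (t2 + t3)) \<le> 100 * (n + 1)"
    using e1(2) e2(2) e3(2) by (simp add: body_defs)
  moreover have "\<forall>a>6. arr s3 a = (\<lambda>_. 0)" using z1 by (simp add: a3 a2)
  ultimately show ?thesis using l3 d3 r3 q2(1) q3 unfolding runs_def by blast
qed

end

context split_input
begin

text \<open>Summed over all loops, the cost per vertex, per pair and per adjacency entry each stays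
  below the round factor 100.\<close>

lemma check_order_runs:
  assumes s: "loaded s" "degs s" "arr s 6 = (\<lambda>v. of_bool (v \<in> S))"
    "\<And>a. a > 6 \<Longrightarrow> arr s a = (\<lambda>_. 0)" "reg s 15 = 0"
  shows "runs W check_order s (100 * (n + m + length (concat adj) + 1))
    (\<lambda>s'. reg s' 0 = (if (\<forall>y\<in>F. card {v\<in>S. B v \<le> D y} = D y) \<and> \<not> conflict (set ps) then 1 else 0))"
proof -
  obtain t1 s1 where e1: "exec W (for_loop 4 1 forced_body) s t1 s1"
      "t1 \<le> m * (cost forced_body + 2) + 2" and q1: "arr s1 7 = (\<lambda>v. of_bool (v \<in> F))"
    using forced_loop[OF s(1-3) s(4)] by (auto simp: runs_def)
  note f1 = exec_frame[OF e1(1)]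
  have l1: "loaded s1" by (rule loaded_frame[OF s(1) f1]) (auto simp: body_defs)
  have a1: "arr s1 a = arr s a" if "a \<noteq> 7" for a
    by (rule frame_arr[OF f1]) (use that in \<open>auto simp: body_defs\<close>)
  have b1: "reg s1 15 = reg s 15" by (rule frame_reg[OF f1]) (auto simp: body_defs)
  have d1: "degs s1" "arr s1 6 = (\<lambda>v. of_bool (v \<in> S))" using s by (simp_all add: degs_def a1)
  obtain t2 s2 where e2: "exec W (for_loop 4 0 block_init_body) s1 t2 s2"
      "t2 \<le> n * (cost block_init_body + 2) + 2" and q2: "\<forall>v<n. arr s2 8 v = block_of {} v"
    using block_init_loop[OF l1 d1 q1] by (auto simp: runs_def)
  note f2 = exec_frame[OF e2(1)]
  have l2: "loaded s2" by (rule loaded_frame[OF l1 f2]) (auto simp: body_defs)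
  have a2: "arr s2 a = arr s1 a" if "a \<noteq> 8" for a
    by (rule frame_arr[OF f2]) (use that in \<open>auto simp: body_defs\<close>)
  have b2: "reg s2 15 = reg s1 15" by (rule frame_reg[OF f2]) (auto simp: body_defs)
  have d2: "degs s2" "arr s2 7 = (\<lambda>v. of_bool (v \<in> F))" using d1 q1 by (simp_all add: degs_def a2)
  obtain t3 s3 where e3: "exec W (for_loop 4 0 block_body) s2 t3 s3"
      "t3 \<le> length (concat adj) * (cost block_edge_body + 2) + n * (cost block_pre + 4) + 2"
    and q3: "\<forall>v<n. arr s3 8 v = B v"
    using block_loop[OF l2 d2 q2] unfolding runs_def by blast
  note f3 = exec_frame[OF e3(1)]
  have l3: "loaded s3" by (rule loaded_frame[OF l2 f3]) (auto simp: body_defs)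
  have a3: "arr s3 a = arr s2 a" if "a \<noteq> 8" for a
    by (rule frame_arr[OF f3]) (use that in \<open>auto simp: body_defs\<close>)
  have b3: "reg s3 15 = reg s2 15" by (rule frame_reg[OF f3]) (auto simp: body_defs)
  have z3: "arr s3 6 = (\<lambda>v. of_bool (v \<in> S))" "arr s3 9 = (\<lambda>_. 0)"
    using d1 s(4)[of 9] by (simp_all add: a3 a2 a1)
  obtain t4 s4 where e4: "exec W (for_loop 4 0 count_body) s3 t4 s4"
      "t4 \<le> n * (cost count_body + 2) + 2" and q4: "\<forall>d. arr s4 9 d = card {v\<in>S. B v = d}"
    using count_loop[OF l3 z3(1) q3 z3(2)] unfolding runs_def by blast
  note f4 = exec_frame[OF e4(1)]
  have l4: "loaded s4" by (rule loaded_frame[OF l3 f4]) (auto simp: body_defs)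
  have a4: "arr s4 a = arr s3 a" if "a \<noteq> 9" for a
    by (rule frame_arr[OF f4]) (use that in \<open>auto simp: body_defs\<close>)
  have b4: "reg s4 15 = reg s3 15" by (rule frame_reg[OF f4]) (auto simp: body_defs)
  let ?mid = "set_reg 12 0 s4"
  have e5: "exec W (Move 12 3) s4 1 ?mid" using exec.Move[of W 12 3 s4] loadedD[OF l4] by simp
  have l5: "loaded ?mid" by (rule loaded_frame[OF l4 exec_frame[OF e5]]) auto
  have q5: "\<forall>d. arr ?mid 9 d = card {v\<in>S. B v = d}" "reg ?mid 12 = 0" using q4 by simp_all
  obtain t6 s6 where e6: "exec W (for_loop 4 0 prefix_body) ?mid t6 s6"
      "t6 \<le> n * (cost prefix_body + 2) + 2" and q6: "\<forall>d<n. arr s6 9 d = card {v\<in>S. B v \<le> d}"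
    using prefix_loop[OF l5 q5] unfolding runs_def by blast
  note f6 = exec_frame[OF e6(1)]
  have l6: "loaded s6" by (rule loaded_frame[OF l5 f6]) (auto simp: body_defs)
  have a6: "arr s6 a = arr s4 a" if "a \<noteq> 9" for a
    using frame_arr[OF f6, of a] that by (auto simp: body_defs)
  have b6: "reg s6 15 = reg s4 15" using frame_reg[OF f6, of 15] by (auto simp: body_defs)
  have d6: "degs s6" "arr s6 7 = (\<lambda>v. of_bool (v \<in> F))" "reg s6 15 = 0"
    using d2 s by (simp_all add: degs_def a6 a4 a3 b6 b4 b3 b2 b1)
  obtain t7 s7 where e7: "exec W (for_loop 4 0 chain_body) s6 t7 s7"
      "t7 \<le> n * (cost chain_body + 2) + 2"
    and q7: "reg s7 15 = of_bool (\<exists>y\<in>F. card {v\<in>S. B v \<le> D y} \<noteq> D y)"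
    using chain_loop[OF l6 d6(1,2) q6 d6(3)] unfolding runs_def by blast
  note f7 = exec_frame[OF e7(1)]
  have l7: "loaded s7" by (rule loaded_frame[OF l6 f7]) (auto simp: body_defs)
  have a7: "arr s7 a = arr s6 a" for a
    by (rule frame_arr[OF f7]) (auto simp: body_defs)
  have d7: "arr s7 6 = (\<lambda>v. of_bool (v \<in> S))" "arr s7 7 = (\<lambda>v. of_bool (v \<in> F))"
    "\<forall>v<n. arr s7 8 v = B v" "arr s7 10 = (\<lambda>_. 0)"
    using d6 z3 q3 s(4)[of 10] by (simp_all add: a7 a6 a4 a3 a2 a1)
  obtain t8 s8 where e8: "exec W (for_loop 4 1 pair_body) s7 t8 s8"
      "t8 \<le> m * (cost pair_body + 2) + 2"
    and q8: "reg s8 15 = of_bool ((\<exists>y\<in>F. card {v\<in>S. B v \<le> D y} \<noteq> D y) \<or> conflict (set ps))"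
    using pair_loop[OF l7 d7 q7] unfolding runs_def by blast
  note f8 = exec_frame[OF e8(1)]
  have l8: "loaded s8" by (rule loaded_frame[OF l7 f8]) (auto simp: body_defs)
  let ?final = "set_reg 0 (reg s8 2 - reg s8 15) s8"
  have e9: "exec W (Sub 0 2 15) s8 1 ?final" by (rule exec.Sub)
  have "exec W check_order s (t1 + (t2 + (t3 + (t4 + (1 + (t6 + (t7 + (t8 + 1)))))))) ?final"
    unfolding check_order_def
    by (rule exec.Seq[OF e1(1) exec.Seq[OF e2(1) exec.Seq[OF e3(1) exec.Seq[OF e4(1)
          exec.Seq[OF e5 exec.Seq[OF e6(1) exec.Seq[OF e7(1) exec.Seq[OF e8(1) e9]]]]]]]])
  moreover have "t1 + (t2 + (t3 + (t4 + (1 + (t6 + (t7 + (t8 + 1))))))) \<le>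
      100 * (n + m + length (concat adj) + 1)"
    using e1(2) e2(2) e3(2) e4(2) e6(2) e7(2) e8(2) by (simp add: body_defs)
  moreover have "reg ?final 0 = (if (\<forall>y\<in>F. card {v\<in>S. B v \<le> D y} = D y) \<and> \<not> conflict (set ps) then 1 else 0)"
    using q8 loadedD[OF l8] by auto
  ultimately show ?thesis unfolding runs_def by blast
qed

end

text \<open>Distinct lists make lengths agree with cardinalities, so block numbers computed from
  lists are those of the criterion; the third clause is regrouped by the common block
  \<open>d\<close> of the two front vertices.\<close>

lemma (in split_input) feasible_iff:
  assumes dist: "\<And>v. v < n \<Longrightarrow> distinct (adj ! v)"
    and order: "split_order {..<n} (\<lambda>v. set (adj ! v)) (set ps) S"
  shows "split_order.feasible {..<n} (\<lambda>v. set (adj ! v)) (set ps) S \<longleftrightarrow>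
    (\<forall>y\<in>F. card {v\<in>S. B v \<le> D y} = D y) \<and> \<not> conflict (set ps)"
proof -
  interpret o: split_order "{..<n}" "\<lambda>v. set (adj ! v)" "set ps" S by (rule order)
  have card: "card (set (adj ! v)) = D v" if "v < n" for v
    using dist[OF that] by (rule distinct_card)
  have "x \<in> o.forced \<longleftrightarrow> x \<in> F" for x
    unfolding o.forced_def forced_by_def using ps_less[of x] card by auto
  then have forced: "o.forced = F" by blast
  have "(\<lambda>y. card (set (adj ! y))) ` {y\<in>F. v \<in> set (adj ! y)} = D ` {y\<in>F. v \<in> set (adj ! y)}" for v
    using card F_less by (intro image_cong) auto
  then have blk: "o.blk v = B v" if "v < n" for v
    using that card by (simp add: o.blk_def block_of_def forced)
  have "{v\<in>S. o.blk v \<le> card (set (adj ! y))} = {v\<in>S. B v \<le> D y}" if "y \<in> F" for y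
    using blk S_sub card[OF F_less[OF that]] by auto
  then have 1: "(\<forall>y\<in>F. card {v\<in>S. o.blk v \<le> card (set (adj ! y))} = card (set (adj ! y))) \<longleftrightarrow>
      (\<forall>y\<in>F. card {v\<in>S. B v \<le> D y} = D y)"
    using card F_less by auto
  have blk_pair: "o.blk x = B x" "o.blk y = B y" if "(x, y) \<in> set ps" for x y
    using ps_less[OF that] blk by auto
  have 2: "(\<forall>(x, y)\<in>set ps. o.blk x \<le> o.blk y) \<longleftrightarrow> (\<forall>(x, y)\<in>set ps. B x \<le> B y)"
    by (rule ball_cong[OF refl]) (auto simp: blk_pair)
  have 3: "((x, v) \<in> set ps \<and> (x', v') \<in> set ps \<and> x \<in> F \<and> x' \<in> F \<and> v \<in> S \<and> v' \<in> S \<and>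
        o.blk x = o.blk v \<and> o.blk x' = o.blk v' \<and> o.blk x = o.blk x' \<longrightarrow> x = x') \<longleftrightarrow>
      ((x, v) \<in> set ps \<and> (x', v') \<in> set ps \<and> x \<in> F \<and> x' \<in> F \<and> v \<in> S \<and> v' \<in> S \<and>
        B x = B v \<and> B x' = B v' \<and> B x = B x' \<longrightarrow> x = x')" for x v x' v'
    using blk_pair by auto
  have 4: "(\<forall>x v x' v'. (x, v) \<in> set ps \<and> (x', v') \<in> set ps \<and> x \<in> F \<and> x' \<in> F \<and> v \<in> S \<and> v' \<in> S \<and>
        B x = B v \<and> B x' = B v' \<and> B x = B x' \<longrightarrow> x = x') \<longleftrightarrow>
      \<not> (\<exists>d. \<exists>x\<in>fronts (set ps) d. \<exists>x'\<in>fronts (set ps) d. x \<noteq> x')"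
    (is "?L \<longleftrightarrow> \<not> ?R")
  proof (intro iffI notI allI impI)
    assume L: ?L and ?R
    then obtain d x x' where f: "x \<in> fronts (set ps) d" "x' \<in> fronts (set ps) d" "x \<noteq> x'" by blast
    from f(1) obtain v where v: "x \<in> F" "B x = d" "v \<in> S" "(x, v) \<in> set ps" "B v = d"
      unfolding fronts_def by blast
    from f(2) obtain v' where v': "x' \<in> F" "B x' = d" "v' \<in> S" "(x', v') \<in> set ps" "B v' = d"
      unfolding fronts_def by blast
    show False using L[rule_format, of x v x' v'] v v' f(3) by simp
  next
    fix x v x' v'
    assume R: "\<not> ?R" and p: "(x, v) \<in> set ps \<and> (x', v') \<in> set ps \<and> x \<in> F \<and> x' \<in> F \<and>
      v \<in> S \<and> v' \<in> S \<and> B x = B v \<and> B x' = B v' \<and> B x = B x'"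
    have "x \<in> fronts (set ps) (B x)" "x' \<in> fronts (set ps) (B x)"
      unfolding fronts_def using p by (auto intro: bexI[of _ v] bexI[of _ v'])
    then show "x = x'" using R by blast
  qed
  show ?thesis
    unfolding o.feasible_def forced 1 2 3 4 conflict_def by (auto simp: not_le)
qed

section \<open>Length of the input in terms of the graph and the order\<close>

lemma card_arcs_le:
  assumes "finite E"
  shows "finite {(u, v). {u, v} \<in> E}" "card {(u, v). {u, v} \<in> E} \<le> 2 * card E"
proof -
  have two: "finite {(u, v). {u, v} = e} \<and> card {(u, v). {u, v} = e} \<le> 2" for e :: "'a set"
  proof (cases "\<exists>a b. e = {a, b}")
    case True
    then obtain a b where "e = {a, b}" by blast
    then have sub: "{(u, v). {u, v} = e} \<subseteq> {(a, b), (b, a)}" by (auto simp: doubleton_eq_iff)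
    have "finite {(u, v). {u, v} = e}" by (rule finite_subset[OF sub]) simp
    moreover have "card {(u, v). {u, v} = e} \<le> card {(a, b), (b, a)}" by (rule card_mono[OF _ sub]) simp
    moreover have "card {(a, b), (b, a)} \<le> 2" using card_length[of "[(a, b), (b, a)]"] by simp
    ultimately show ?thesis by linarith
  next
    case False
    then have "{(u, v). {u, v} = e} = {}" by auto
    then show ?thesis by simp
  qed
  have eq: "{(u, v). {u, v} \<in> E} = (\<Union>e\<in>E. {(u, v). {u, v} = e})" by auto
  show "finite {(u, v). {u, v} \<in> E}" unfolding eq using assms two by auto
  have "card {(u, v). {u, v} \<in> E} \<le> (\<Sum>e\<in>E. card {(u, v). {u, v} = e})"
    unfolding eq by (rule card_UN_le[OF assms])
  also have "\<dots> \<le> (\<Sum>e\<in>E. 2)" using two by (intro sum_mono) auto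
  finally show "card {(u, v). {u, v} \<in> E} \<le> 2 * card E" by simp
qed

text \<open>Each adjacency entry is an ordered pair of adjacent vertices, and an edge carries at
  most two of those.\<close>

lemma length_concat_adj_le:
  assumes rep: "represents V E \<pi> vs adj ps" and E: "finite E"
  shows "length (concat adj) \<le> 2 * card E"
proof -
  have vs: "distinct vs" "length adj = length vs"
    and adj: "\<And>i. i < length vs \<Longrightarrow> distinct (adj ! i) \<and>
      set (adj ! i) = {j. j < length vs \<and> {vs ! i, vs ! j} \<in> E}"
    using rep by (auto simp: represents_def)
  let ?S = "Sigma {..<length adj} (\<lambda>i. set (adj ! i))"
  have "length (concat adj) = (\<Sum>i<length adj. length (adj ! i))"
    by (simp add: length_concat sum_list_sum_nth atLeast0LessThan)
  also have "\<dots> = (\<Sum>i<length adj. card (set (adj ! i)))"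
    using adj vs by (intro sum.cong refl distinct_card[symmetric]) auto
  also have "\<dots> = card ?S" by (rule card_SigmaI[symmetric]) auto
  also have "\<dots> = card ((\<lambda>(i, j). (vs ! i, vs ! j)) ` ?S)"
  proof (rule card_image[symmetric], rule inj_onI)
    fix p q assume "p \<in> ?S" "q \<in> ?S" and eq: "(\<lambda>(i, j). (vs ! i, vs ! j)) p = (\<lambda>(i, j). (vs ! i, vs ! j)) q"
    then have "fst p < length vs" "fst q < length vs" "snd p < length vs" "snd q < length vs"
      using adj vs by auto
    then show "p = q"
      using eq nth_eq_iff_index_eq[OF vs(1)] by (auto simp: case_prod_beta prod_eq_iff)
  qed
  also have "\<dots> \<le> card {(u, v). {u, v} \<in> E}"
    using adj vs by (intro card_mono card_arcs_le(1) E) auto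
  also have "\<dots> \<le> 2 * card E" by (rule card_arcs_le(2)[OF E])
  finally show ?thesis .
qed

lemma length_pairs:
  assumes rep: "represents V E \<pi> vs adj ps" and \<pi>: "\<pi> \<subseteq> V \<times> V"
  shows "length ps = card \<pi>"
proof -
  have vs: "distinct vs" "set vs = V" and ps: "distinct ps"
    "set ps = {(i, j). i < length vs \<and> j < length vs \<and> (vs ! i, vs ! j) \<in> \<pi>}"
    using rep by (auto simp: represents_def)
  have "inj_on (\<lambda>(i, j). (vs ! i, vs ! j)) (set ps)"
    using nth_eq_iff_index_eq[OF vs(1)] unfolding ps(2) by (auto simp: inj_on_def)
  moreover have "(\<lambda>(i, j). (vs ! i, vs ! j)) ` set ps = \<pi>"
  proof (intro equalityI subrelI)
    fix x y assume xy: "(x, y) \<in> \<pi>"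
    then have "x \<in> set vs" "y \<in> set vs" using \<pi> vs by auto
    then obtain i j where "i < length vs" "x = vs ! i" "j < length vs" "y = vs ! j"
      by (metis in_set_conv_nth)
    then show "(x, y) \<in> (\<lambda>(i, j). (vs ! i, vs ! j)) ` set ps"
      using xy by (force simp: ps(2))
  qed (auto simp: ps(2))
  ultimately have "card \<pi> = card (set ps)" using card_image by metis
  then show ?thesis using distinct_card[OF ps(1)] by simp
qed

lemma partial_order_on_indices:
  assumes vs: "distinct vs" "set vs = V" and \<pi>: "partial_order_on V \<pi>"
  shows "partial_order_on {..<length vs}
    {(i, j). i < length vs \<and> j < length vs \<and> (vs ! i, vs ! j) \<in> \<pi>}"
proof -
  have po: "refl_on V \<pi>" "trans \<pi>" "antisym \<pi>" using partial_order_onD[OF \<pi>] by auto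
  show ?thesis
    unfolding partial_order_on_def preorder_on_def
  proof (intro conjI)
    show "refl_on {..<length vs} {(i, j). i < length vs \<and> j < length vs \<and> (vs ! i, vs ! j) \<in> \<pi>}"
      using refl_onD[OF po(1)] vs(2) by (auto intro: refl_onI)
    show "trans {(i, j). i < length vs \<and> j < length vs \<and> (vs ! i, vs ! j) \<in> \<pi>}"
      by (rule transI) (auto intro: transD[OF po(2)])
    show "antisym {(i, j). i < length vs \<and> j < length vs \<and> (vs ! i, vs ! j) \<in> \<pi>}"
      using nth_eq_iff_index_eq[OF vs(1)] antisymD[OF po(3)] by (intro antisymI) blast
  qed auto
qed

text \<open>Everything is moved to the indices of \<open>vs\<close>, where the criterion, the
  rankings and the loops meet.\<close>

lemma decide_correct:
  fixes V :: "nat set"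
  assumes graph: "simple_graph V E" "connected_graph V E" "split_graph V E"
    and \<pi>: "partial_order_on V \<pi>" and rep: "represents V E \<pi> vs adj ps"
    and N: "N = card V + card E + card \<pi>"
  shows "runs ((N + 1) ^ 3) (Seq find_clique check_order) (input_state adj ps) (1000 * N)
    (\<lambda>s. reg s 0 = (if \<exists>xs. mcs_ordering V E xs \<and> linear_extension V \<pi> xs then 1 else 0))"
proof -
  let ?W = "(N + 1) ^ 3" and ?n = "length adj" and ?N = "\<lambda>v. set (adj ! v)"
  have vs: "distinct vs" "set vs = V" "length vs = ?n"
    and adj: "\<And>i. i < ?n \<Longrightarrow> distinct (adj ! i)"
      "\<And>i. i < ?n \<Longrightarrow> ?N i = {j. j < ?n \<and> {vs ! i, vs ! j} \<in> E}"
    and ps: "distinct ps" "set ps = {(i, j). i < ?n \<and> j < ?n \<and> (vs ! i, vs ! j) \<in> \<pi>}"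
    using rep by (auto simp: represents_def)
  have finV: "finite V" and E: "\<And>e. e \<in> E \<Longrightarrow> \<exists>u\<in>V. \<exists>v\<in>V. u \<noteq> v \<and> e = {u, v}"
    using graph by (auto simp: simple_graph_def)
  have "E \<subseteq> Pow V" using E by blast
  then have finE: "finite E" using finV finite_subset by blast
  have n: "card V = ?n" using vs distinct_card by metis
  have "0 < ?n" using graph(2) vs n finV by (auto simp: connected_graph_def card_gt_0_iff)
  have L: "length (concat adj) \<le> 2 * card E" by (rule length_concat_adj_le[OF rep finE])
  have m: "length ps = card \<pi>" by (rule length_pairs[OF rep partial_order_onD(4)[OF \<pi>]])
  have "N \<ge> 1" using N n \<open>0 < ?n\<close> by linarith
  \<comment> \<open>The cube provides at least \<open>4 * (N + 1)\<close>, which exceeds the edge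
    array length (at most \<open>2 * card E\<close>), the number of pairs and the largest block
    number \<open>card V + 1\<close>. Being polynomial in \<open>N\<close>, it still means words of
    logarithmic length.\<close>
  have "?W = (N + 1) * (N + 1) * (N + 1)" by (simp add: power3_eq_cube)
  also have "\<dots> \<ge> 2 * 2 * (N + 1)" using \<open>N \<ge> 1\<close> by (intro mult_mono) auto
  finally have W: "4 * (N + 1) \<le> ?W" by simp
  have irrefl: "{x, x} \<notin> E" for x using E[of "{x, x}"] by (auto simp: doubleton_eq_iff)
  have nb: "neighbourhoods {..<?n} ?N"
    by unfold_locales (use adj irrefl in \<open>auto simp: insert_commute\<close>)
  interpret nb: neighbourhoods "{..<?n}" ?N by (rule nb)
  have "input_lists adj ps ?W"
  proof
    fix v assume v: "v < ?n"
    show "?N v \<subseteq> {..<?n}" using adj v by auto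
    have "?N v \<subset> {..<?n}" using nb.N_irrefl[of v] nb.N_sub[of v] v by auto
    from psubset_card_mono[OF _ this] show "length (adj ! v) < ?n"
      using adj(1)[OF v] by (simp add: distinct_card)
  qed (use ps L m N n W in auto)
  then interpret input_lists adj ps ?W .
  have split: "\<exists>K. nb.split_part K"
  proof -
    obtain K I where KI: "K \<union> I = V" "clique E K" "independent E I"
      using graph(3) by (auto simp: split_graph_def)
    have mem: "vs ! i \<in> K \<or> vs ! i \<in> I" if "i < ?n" for i using vs KI(1) that nth_mem[of i vs] by auto
    have "nb.split_part {i. i < ?n \<and> vs ! i \<in> K}"
      unfolding nb.split_part_def
    proof (intro conjI ballI impI)
      fix u v assume "u \<in> {i. i < ?n \<and> vs ! i \<in> K}" "v \<in> {i. i < ?n \<and> vs ! i \<in> K}" "u \<noteq> v"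
      then show "v \<in> ?N u"
        using KI(2) adj(2) vs nth_eq_iff_index_eq[OF vs(1)] by (simp add: clique_def)
    next
      fix u v assume uv: "u \<in> {..<?n} - {i. i < ?n \<and> vs ! i \<in> K}" "v \<in> {..<?n} - {i. i < ?n \<and> vs ! i \<in> K}"
      then have "vs ! u \<in> I" "vs ! v \<in> I" using mem by auto
      then show "v \<notin> ?N u" using KI(3) adj(2)[of u] uv by (simp add: independent_def)
    qed auto
    then show ?thesis by blast
  qed
  have "runs ?W (Seq find_clique check_order) (input_state adj ps)
      (100 * (?n + 1) + 100 * (?n + length ps + length (concat adj) + 1))
      (\<lambda>s. reg s 0 = (if \<exists>xs. mcs_ordering V E xs \<and> linear_extension V \<pi> xs then 1 else 0))"
  proof (rule runs_Seq[OF find_clique_runs[OF \<open>0 < ?n\<close>]], elim conjE exE)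
    fix s S k
    assume s: "loaded s" "degs s" "\<forall>a>6. arr s a = (\<lambda>_. 0)" "reg s 15 = 0"
      "arr s 6 = (\<lambda>v. of_bool (v \<in> S))"
      and k: "clique_number k" and S: "{v. v < ?n \<and> k \<le> length (adj ! v)} \<subseteq> S"
      "S \<subseteq> {v. v < ?n \<and> k \<le> length (adj ! v) + 1}" "card S = k"
    have card: "card (?N v) = length (adj ! v)" if "v < ?n" for v
      using adj(1)[OF that] by (rule distinct_card)
    have ge: "{v\<in>{..<?n}. i \<le> card (?N v) + 1} = {v. v < ?n \<and> i - 1 \<le> length (adj ! v)}"
      if "0 < i" for i using card that by auto
    have part: "nb.split_part S"
    proof (rule nb.split_part_by_degree[OF split])
      show "k \<le> card {v\<in>{..<?n}. k \<le> card (?N v) + 1}"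
        using k ge[of k] by (simp add: clique_number_def ge_def)
      show "card {v\<in>{..<?n}. i \<le> card (?N v) + 1} < i" if "k < i" for i
        using k ge[of i] that by (simp add: clique_number_def ge_def)
    qed (use S card in auto)
    have order: "split_order {..<?n} ?N (set ps) S"
      unfolding ps(2) using part partial_order_on_indices[OF vs(1,2) \<pi>] vs(3)
      by unfold_locales simp_all
    interpret o: split_order "{..<?n}" ?N "set ps" S by (rule order)
    have "split_input adj ps ?W S"
    proof
      show "set (adj ! v) \<subseteq> S" if "v < ?n" "v \<notin> S" for v
        using o.indep_N[of v] that by simp
    qed (rule o.K_sub)
    then interpret si: split_input adj ps ?W S .
    have rank_eq: "search_rank {..<?n} ?N f \<longleftrightarrow> search_rank {..<length vs}
        (\<lambda>i. {j. j < length vs \<and> {vs ! i, vs ! j} \<in> E}) f" for f :: "nat \<Rightarrow> 'b::linorder"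
      using adj(2) by (simp add: search_rank_def vs(3))
    have "(\<exists>xs. mcs_ordering V E xs \<and> linear_extension V \<pi> xs) \<longleftrightarrow> o.feasible"
    proof
      assume "\<exists>xs. mcs_ordering V E xs \<and> linear_extension V \<pi> xs"
      then obtain f :: "nat \<Rightarrow> nat" where "search_rank {..<?n} ?N f" "extends (set ps) f"
        using rank_if_ordering[OF vs(1,2)] unfolding rank_eq ps(2) vs(3) by blast
      then show o.feasible by (rule o.feasible_if_rank)
    next
      assume o.feasible
      \<comment> \<open>The vertices are indices here, so \<open>id\<close> serves as the injective
        tie-breaker.\<close>
      from o.rank_if_feasible[OF this, of id] obtain f :: "nat \<Rightarrow> nat \<times> nat \<times> nat \<times> nat"
        where "search_rank {..<?n} ?N f" "extends (set ps) f" by auto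
      then show "\<exists>xs. mcs_ordering V E xs \<and> linear_extension V \<pi> xs"
        using ordering_if_rank[OF vs(1,2) partial_order_onD(4)[OF \<pi>]]
        unfolding rank_eq ps(2) vs(3) by blast
    qed
    then have "(\<exists>xs. mcs_ordering V E xs \<and> linear_extension V \<pi> xs) \<longleftrightarrow>
        (\<forall>y\<in>si.F. card {v\<in>S. si.B v \<le> length (adj ! y)} = length (adj ! y)) \<and> \<not> si.conflict (set ps)"
      using si.feasible_iff[OF adj(1) order] by simp
    then show "runs ?W check_order s (100 * (?n + length ps + length (concat adj) + 1))
      (\<lambda>s. reg s 0 = (if \<exists>xs. mcs_ordering V E xs \<and> linear_extension V \<pi> xs then 1 else 0))"
      using si.check_order_runs[OF s(1,2,5) _ s(4)] s(3) by simp
  qed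
  then show ?thesis
  proof (rule runs_mono)
    \<comment> \<open>As \<open>card V\<close> is positive it absorbs the additive constants, and
      adjacency entries number at most twice the edges; 1000 is a generous common factor.\<close>
    have "100 * (a + 1) + 100 * (a + b + l + 1) \<le> 1000 * (a + e + b)" if "l \<le> 2 * e" "0 < a"
      for a b e l :: nat using that by simp
    from this[OF L \<open>0 < ?n\<close>]
    show "100 * (?n + 1) + 100 * (?n + length ps + length (concat adj) + 1) \<le> 1000 * N"
      unfolding N n m .
  qed
qed

theorem theorem4:
  shows "\<exists>(P :: prog) (c :: nat) (k :: nat).
    \<forall>(V :: nat set) (E :: nat set set) (\<pi> :: (nat \<times> nat) set) vs adj ps.
      simple_graph V E \<longrightarrow> connected_graph V E \<longrightarrow> split_graph V E \<longrightarrow>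
      partial_order_on V \<pi> \<longrightarrow> represents V E \<pi> vs adj ps \<longrightarrow>
      (let N = card V + card E + card \<pi> in
        \<exists>t s. exec ((N + 1) ^ k) P (input_state adj ps) t s \<and> t \<le> c * N \<and>
          reg s 0 = (if \<exists>xs. mcs_ordering V E xs \<and> linear_extension V \<pi> xs then 1 else 0))"
  using decide_correct[unfolded runs_def]
  by (intro exI[of _ "Seq find_clique check_order"] exI[of _ 1000] exI[of _ 3]) (simp add: Let_def)

end
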